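(* Let $p$ be a prime, $R\ge 1$, $q=p^R$, $V=\mathbb{F}_q$, and let $k$ be a divisor of $q-1$ such that $k\ge 2$ and either $q$ or $\frac{q-1}{k}$ is even. Let $\omega$ be a primitive element of $\mathbb{F}_q$, let $S=\langle\omega^k\rangle\le\mathbb{F}_q^*$, let $\Gamma=\mathrm{GPaley}(q,\frac{q-1}{k})=\mathrm{Cay}(V,S)$, and let $\mathrm{Cyc}(q,k)$ be the $k$-class symmetric cyclotomic scheme on $V$. Let $\widehat{\omega}:V\to V$ be the map $x\mapsto x\omega$. (1) The following are equivalent: (i) $\Gamma$ is connected; (ii) $\mathrm{Cyc}(q,k)$ is primitive; (iii) $\langle\widehat{\omega}^k\rangle$ acts irreducibly on $V$ (as an $\mathbb{F}_p$-vector space); (iv) $k$ is not a multiple of $\frac{q-1}{p^a-1}$ for any proper divisor $a$ of $R$. (2) Suppose that $k$ is a multiple of $\frac{q-1}{p^a-1}$, where $a$ is a proper divisor of $R$, so that $\Gamma$ is not connected. Then the connected components of $\Gamma$ are all isomorphic, and the component $\Gamma_0$ containing $0$ has vertex set $\mathbb{F}_{p^a}$ (a proper subfield of $\mathbb{F}_q$) containing $S$, and is isomorphic to $\mathrm{GPaley}(p^a,\frac{p^a-1}{k'})$, where $k'=\frac{p^a-1}{q-1}\,k\ge 1$. Furthermore, $\mathrm{Aut}(\Gamma)=\mathrm{Aut}(\Gamma_0)\wr S_{p^{R-a}}$.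
   Context: All graphs are finite, undirected, without loops or multiple edges. A proper divisor $a$ of $R$ is a positive divisor with $1\le a<R$. Generalised Paley graph: $\mathrm{GPaley}(q,\frac{q-1}{k})$ has vertex set $\mathbb{F}_q$ and edges all pairs $\{x,y\}$ with $x-y\in S$, where $S$ is the unique subgroup of order $\frac{q-1}{k}$ of $\mathbb{F}_q^*$ (under the parity condition, $S=-S$). It is the Cayley graph $\mathrm{Cay}(V,S)$ of the additive group $V$ of $\mathbb{F}_q$, i.e. $x,y$ are adjacent iff $x-y\in S$. In part (2), $k'$ may equal $1$; in that case $\mathrm{GPaley}(p^a,\frac{p^a-1}{k'})$ denotes $\mathrm{Cay}(\mathbb{F}_{p^a},S)$ with $S=\mathbb{F}_{p^a}^*$, which is isomorphic to the complete graph $K_{p^a}$. Cyclotomic scheme: $\mathrm{Cyc}(q,k)=(V,\{R_0,\dots,R_k\})$ with $R_0=\{(x,x)\mid x\in V\}$ and $R_i=\{(x,y)\mid y-x\in\langle\omega^k\rangle\omega^i\}$ for $1\le i\le k$. For $1\le i\le k$ the relation graph $\Gamma_i$ has vertex set $V$ and edges $\{x,y\}$ with $(x,y)\in R_i$. The scheme is primitive if every $\Gamma_i$ ($1\le i\le k$) is connected. For a group $H$ and positive integer $b$, $H\wr S_b=H^b\rtimes S_b$ with the symmetric group $S_b$ permuting the entries of $H^b$. In part (2), $\mathrm{Aut}(\Gamma_0)\wr S_{p^{R-a}}$ acts on the vertex set of $\Gamma$, viewed as the disjoint union of $p^{R-a}$ components (each identified with $\Gamma_0$), the base group acting componentwise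 and $S_{p^{R-a}}$ permuting the components.
   Formalization: In part (2), that Γ_0 has vertex set F_{p^a}, is GPaley(p^a,(p^a-1)/k'), and Aut(Γ)=Aut(Γ_0) wr S_{p^{R-a}} are stated only for the least proper divisor a with (q-1)/(p^a-1) dividing k; they fail for larger a, e.g. q=16, k=15, a=2, where S={1} and Γ_0 has vertex set F_2. *)

theory Defs
  imports
    "HOL-Computational_Algebra.Primes"
    "HOL-Algebra.Bij"
    "HOL-Algebra.Product_Groups"
    "HOL-Algebra.Sym_Groups"
    "HOL-Algebra.Embedded_Algebras"
    "HOL-Algebra.Generated_Fields"
    "HOL-Algebra.Multiplicative_Group"
    "Graph_Theory.Graph_Theory"
begin

section \<open>Graphs\<close>

text \<open>
  Following the Graph-Theory entry, an undirected graph is a symmetric digraph; a simple one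
  is an instance of the locale \<^locale>\<open>graph\<close>, here always with pairs of vertices as arcs.
\<close>

definition components :: "('a, 'b) pre_digraph \<Rightarrow> ('a, 'b) pre_digraph set" where
  "components G = {H. pre_digraph.max_subgraph G Digraph_Component.connected H}"

text \<open>As in \<^const>\<open>BijGroup\<close>, permutations of \<open>verts G\<close> are \<^const>\<open>undefined\<close> elsewhere.\<close>

definition aut_group :: "('a, 'b) pre_digraph \<Rightarrow> ('a \<Rightarrow> 'a) monoid" where
  "aut_group G = BijGroup (verts G)
     \<lparr>carrier := {f \<in> Bij (verts G). \<forall>u \<in> verts G. \<forall>v \<in> verts G.
        (u, v) \<in> arcs_ends G \<longleftrightarrow> (f u, f v) \<in> arcs_ends G}\<rparr>"


section \<open>Cayley graphs and generalised Paley graphs\<close>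

text \<open>The Cayley graph of the additive group of \<open>F\<close>; it is undirected when \<open>S = -S\<close>.\<close>

definition cay_graph :: "('a, 'm) ring_scheme \<Rightarrow> 'a set \<Rightarrow> ('a, 'a \<times> 'a) pre_digraph" where
  "cay_graph F S = with_proj
     \<lparr>pverts = carrier F,
      parcs = {(x, y). x \<in> carrier F \<and> y \<in> carrier F \<and> x \<ominus>\<^bsub>F\<^esub> y \<in> S}\<rparr>"

text \<open>
  \<open>gpaley F n\<close> is \<open>GPaley(q, n)\<close> for a finite field \<open>F\<close> of order \<open>q\<close>. For \<open>n\<close> dividing
  \<open>q - 1\<close> the cyclic group \<open>F\<^sup>*\<close> has exactly one subgroup of order \<open>n\<close>.
\<close>

definition gpaley :: "('a, 'm) ring_scheme \<Rightarrow> nat \<Rightarrow> ('a, 'a \<times> 'a) pre_digraph" where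
  "gpaley F n = cay_graph F (THE S. subgroup S (mult_of F) \<and> card S = n)"


section \<open>Cyclotomic schemes\<close>

record 'a scheme_data =
  scheme_points :: "'a set"
  scheme_classes :: nat
  scheme_rel :: "nat \<Rightarrow> ('a \<times> 'a) set"

definition cyc :: "('a, 'm) ring_scheme \<Rightarrow> 'a \<Rightarrow> nat \<Rightarrow> 'a scheme_data" where
  "cyc F \<omega> k =
     \<lparr>scheme_points = carrier F,
      scheme_classes = k,
      scheme_rel = (\<lambda>i. if i = 0 then Id_on (carrier F)
        else {(x, y). x \<in> carrier F \<and> y \<in> carrier F \<and>
          y \<ominus>\<^bsub>F\<^esub> x \<in> generate (mult_of F) {\<omega> [^]\<^bsub>F\<^esub> k} #>\<^bsub>mult_of F\<^esub> (\<omega> [^]\<^bsub>F\<^esub> i)})\<rparr>"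

text \<open>The edge \<open>{x, y}\<close> is present as soon as one of its orientations lies in the relation.\<close>

definition relation_graph :: "'a scheme_data \<Rightarrow> nat \<Rightarrow> ('a, 'a \<times> 'a) pre_digraph" where
  "relation_graph A i = with_proj
     \<lparr>pverts = scheme_points A, parcs = scheme_rel A i \<union> converse (scheme_rel A i)\<rparr>"

definition primitive_scheme :: "'a scheme_data \<Rightarrow> bool" where
  "primitive_scheme A \<longleftrightarrow>
     (\<forall>i \<in> {1..scheme_classes A}. Digraph_Component.connected (relation_graph A i))"


section \<open>Irreducible linear actions\<close>

definition mult_map :: "('a, 'm) ring_scheme \<Rightarrow> 'a \<Rightarrow> 'a \<Rightarrow> 'a" where
  "mult_map F \<omega> = (\<lambda>x \<in> carrier F. x \<otimes>\<^bsub>F\<^esub> \<omega>)"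

text \<open>
  \<open>generate_field F {}\<close> is the prime field of \<open>F\<close>. Despite its name, \<^term>\<open>subalgebra K W F\<close>
  says that \<open>W\<close> is a \<open>K\<close>-linear subspace of \<open>F\<close>; closure of \<open>W\<close> under products is not
  required.
\<close>

definition acts_irreducibly :: "('a, 'm) ring_scheme \<Rightarrow> ('a \<Rightarrow> 'a) set \<Rightarrow> bool" where
  "acts_irreducibly F H \<longleftrightarrow>
     carrier F \<noteq> {\<zero>\<^bsub>F\<^esub>} \<and>
     (\<forall>W. subalgebra (generate_field F {}) W F \<and> (\<forall>h \<in> H. h ` W \<subseteq> W) \<longrightarrow>
        W = {\<zero>\<^bsub>F\<^esub>} \<or> W = carrier F)"


section \<open>Wreath products with symmetric groups\<close>

text \<open>
  \<open>H wr S_b\<close> as the semidirect product of \<open>H\<^sup>b\<close> and \<open>S_b\<close>. Permutations are composed from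
  right to left, so \<open>\<sigma>\<close> sends \<open>g\<close> to \<open>i \<mapsto> g (\<sigma>\<^sup>-\<^sup>1 i)\<close>.
\<close>

definition wreath_sym ::
  "('h, 'm) monoid_scheme \<Rightarrow> nat \<Rightarrow> ((nat \<Rightarrow> 'h) \<times> (nat \<Rightarrow> nat)) monoid" where
  "wreath_sym H b =
     \<lparr>carrier = carrier (product_group {1..b} (\<lambda>_. H)) \<times> carrier (sym_group b),
      monoid.mult = (\<lambda>(f, \<sigma>) (g, \<tau>).
        (f \<otimes>\<^bsub>product_group {1..b} (\<lambda>_. H)\<^esub> (\<lambda>i \<in> {1..b}. g (inv_into UNIV \<sigma> i)),
         \<sigma> \<otimes>\<^bsub>sym_group b\<^esub> \<tau>)),
      monoid.one = (\<one>\<^bsub>product_group {1..b} (\<lambda>_. H)\<^esub>, \<one>\<^bsub>sym_group b\<^esub>)\<rparr>"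

text \<open>
  An enumeration \<open>C\<^sub>1, \<dots>, C\<^sub>b\<close> of the components of \<open>G\<close> without repetition, together with
  isomorphisms \<open>\<Phi> i\<close> from \<open>G0\<close> onto \<open>C\<^sub>i\<close>; the latter is \<open>app_iso (\<Phi> i) G0\<close>.
\<close>

definition component_identification ::
  "('a, 'b) pre_digraph \<Rightarrow> ('a, 'b) pre_digraph \<Rightarrow> nat \<Rightarrow>
    (nat \<Rightarrow> ('a, 'b, 'a, 'b) digraph_isomorphism) \<Rightarrow> bool" where
  "component_identification G G0 b \<Phi> \<longleftrightarrow>
     (\<forall>i \<in> {1..b}. pre_digraph.digraph_isomorphism G0 (\<Phi> i)) \<and>
     bij_betw (\<lambda>i. app_iso (\<Phi> i) G0) {1..b} (components G)"

text \<open>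
  The permutation of \<open>verts G\<close> induced by \<open>(f, \<sigma>)\<close> when the vertex \<open>iso_verts (\<Phi> i) x\<close> of
  \<open>G\<close> is written as \<open>(i, x)\<close>: first \<open>\<sigma>\<close> moves \<open>(i, x)\<close> to \<open>(\<sigma> i, x)\<close>, then \<open>f\<close> acts
  componentwise.
\<close>

definition wreath_action ::
  "('a, 'b) pre_digraph \<Rightarrow> ('a, 'b) pre_digraph \<Rightarrow> nat \<Rightarrow>
    (nat \<Rightarrow> ('a, 'b, 'a, 'b) digraph_isomorphism) \<Rightarrow>
    (nat \<Rightarrow> 'a \<Rightarrow> 'a) \<times> (nat \<Rightarrow> nat) \<Rightarrow> 'a \<Rightarrow> 'a" where
  "wreath_action G G0 b \<Phi> = (\<lambda>(f, \<sigma>). \<lambda>v \<in> verts G.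
     case inv_into ({1..b} \<times> verts G0) (\<lambda>(i, x). iso_verts (\<Phi> i) x) v of
       (i, x) \<Rightarrow> iso_verts (\<Phi> (\<sigma> i)) (f (\<sigma> i) x))"

end

theory Submission
  imports Defs
begin

text \<open>
  The component of \<open>0\<close> in a Cayley graph is the additive span \<open>W\<close> of the connection set, and the
  other components are its cosets. Since \<open>S\<close> is a subgroup of \<open>F\<^sup>*\<close>, the span \<open>W\<close> is closed under
  products and hence, being finite, a subfield. So all conditions of part (1) express \<open>W = F\<close>:
  scaling by \<open>\<omega>\<^sup>i\<close> maps spans to spans, and \<open>W w\<close> lies in every \<open>S\<close>-invariant subspace containing
  \<open>w\<close>. As \<open>F\<^sup>*\<close> has at most one subgroup of each order, \<open>S\<close> lies in the subfield of order \<open>p\<^sup>a\<close>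
  iff \<open>|S| = (q - 1) / k\<close> divides \<open>p\<^sup>a - 1\<close>, that is, iff \<open>(q - 1) / (p\<^sup>a - 1)\<close> divides \<open>k\<close>; for the
  least such \<open>a\<close> this subfield is \<open>W\<close>.
\<close>

section \<open>Components of symmetric digraphs\<close>

text \<open>The difficulty in part (2) is a non-minimal \<open>a\<close>: the component of zero can
  then be smaller than the subfield of order \<open>p ^ a\<close>. For q = 16 and k = 15 both a = 1
  and a = 2 are admissible, yet S = {1} and the component of zero is the subfield of order 2. So
  \<open>W\<close> is the primary object, and for general \<open>a\<close> a subfield
  \<open>K\<close> of order \<open>p ^ a\<close> is only shown to contain it. Equality comes from
  minimality by counting: |W| = p ^ c, where c is itself admissible unless W = F. The subfield
  \<open>K\<close> is found as the fixed points of x |-> x ^ (p ^ a), which is why the binomial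
  theorem and the additivity of the Frobenius map are developed. The wreath product claim has
  nothing to do with fields: it is proved for every finite symmetric digraph with a component
  identification, in coordinates (component, point).\<close>

lemma subgraph_antisym:
  assumes "subgraph G H" "subgraph H G"
  shows "G = H"
proof (rule pre_digraph.equality)
  show "verts G = verts H" "arcs G = arcs H"
    using assms unfolding subgraph_def by blast+
  show "tail G = tail H" "head G = head H"
    using assms(1) unfolding subgraph_def compatible_def by auto
qed simp

text \<open>Adding arcs on the same vertices cannot destroy connectedness; this makes every maximal
  connected subgraph an induced one.\<close>

lemma arc_mono_connected: "arc_mono Digraph_Component.connected"
  unfolding arc_mono_def
  by (metis spanning_def subgraphE wf_digraph.connected_spanning_imp_connected)

lemma (in wf_digraph) strongly_connected_imp_connected:
  assumes "strongly_connected G"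
  shows "Digraph_Component.connected G"
  using assms reachable_mk_symmetricI
  by (intro connectedI) (auto simp: strongly_connected_def)

lemma (in sym_digraph) connected_iff_strongly_connected:
  "Digraph_Component.connected G \<longleftrightarrow> strongly_connected G"
  using strongly_connected_imp_connected symmetric_connected_imp_strongly_connected sym_arcs
  by blast

text \<open>Induced subgraphs of a symmetric digraph are symmetric, and there weak and strong
  connectedness agree. The equation gives access to the facts that strong components are disjoint
  and cover the vertices.\<close>

lemma (in sym_digraph) components_eq_sccs: "components G = sccs"
proof -
  have strong: "strongly_connected H"
    if "Digraph_Component.connected H" "induced_subgraph H G" for H
  proof -
    interpret H: sym_digraph H using that(2) by (rule induced_graph_imp_graph)
    show ?thesis using that(1) H.connected_iff_strongly_connected by simp
  qed
  have conn: "Digraph_Component.connected H" if "strongly_connected H" "subgraph H G" for H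
    using that wf_digraph.strongly_connected_imp_connected by blast
  have "max_subgraph Digraph_Component.connected H \<longleftrightarrow> max_subgraph strongly_connected H" for H
  proof
    assume H: "max_subgraph Digraph_Component.connected H"
    have "induced_subgraph H G"
      using H arc_mono_connected by (rule induced_subgraphI_arc_mono)
    with H show "max_subgraph strongly_connected H"
      unfolding max_subgraph_def using strong conn by blast
  next
    assume H: "max_subgraph strongly_connected H"
    show "max_subgraph Digraph_Component.connected H"
    proof (rule max_subgraphI)
      show "subgraph H G" "Digraph_Component.connected H"
        using H conn by (auto simp: max_subgraph_def)
    next
      fix K assume K: "H \<noteq> K" "subgraph H K" "subgraph K G"
      show "\<not> Digraph_Component.connected K"
      proof
        assume cK: "Digraph_Component.connected K"
        \<comment> \<open>\<open>K\<close> may contain an arc without its reverse, so it need not be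
          strongly connected. The induced subgraph on the same vertices is symmetric and still
          connected.\<close>
        let ?L = "G \<restriction> verts K"
        have sub: "verts K \<subseteq> verts G" using K by auto
        have KL: "subgraph K ?L" using K(3) by (rule subgraph_induce_subgraphI2)
        have "Digraph_Component.connected ?L"
          using arc_mono_connected cK KL unfolding arc_mono_def
            by (metis induce_subgraph_verts)
        then have "strongly_connected ?L" using sub by (intro strong) auto
        moreover have "subgraph H ?L" using K(2) KL by (rule subgraph_trans)
        moreover have "subgraph ?L G" using sub by (rule subgraph_induce_subgraphI)
        ultimately have "?L = H" using H unfolding max_subgraph_def by blast
        with K(1,2) KL show False using subgraph_antisym by blast
      qed
    qed
  qed
  then show ?thesis by (simp add: components_def sccs_altdef2)
qed

lemma (in sym_digraph) components_eq_reachable: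
  "components G = (\<lambda>u. G \<restriction> {v. u \<rightarrow>\<^sup>* v}) ` verts G"
proof -
  have "scc_of u = {v. u \<rightarrow>\<^sup>* v}" for u
    using symmetric_reachable[OF sym_arcs] by (auto simp: scc_of_def)
  then show ?thesis
    by (simp add: components_eq_sccs sccs_conv_sccs_verts sccs_verts_conv_scc_of image_image)
qed


section \<open>Connectedness of Cayley graphs\<close>

no_notation vwalk_join (infixr \<open>\<oplus>\<close> 65)

context ring begin

lemma minus_diff_eq: "x \<in> carrier R \<Longrightarrow> y \<in> carrier R \<Longrightarrow> \<ominus> (x \<ominus> y) = y \<ominus> x"
  by (simp add: minus_eq minus_add a_comm)

lemma diff_add_diff:
  "x \<in> carrier R \<Longrightarrow> y \<in> carrier R \<Longrightarrow> z \<in> carrier R \<Longrightarrow> (x \<ominus> y) \<oplus> (y \<ominus> z) = x \<ominus> z"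
  by (simp add: minus_eq a_assoc r_neg1 r_neg2)

lemma add_diff_add_right:
  assumes "x \<in> carrier R" "y \<in> carrier R" "d \<in> carrier R"
  shows "(x \<oplus> d) \<ominus> (y \<oplus> d) = x \<ominus> y"
  using assms by (simp add: minus_eq minus_add a_assoc a_comm[of "\<ominus> y" "\<ominus> d"] r_neg2)

lemma mem_add_r_coset:
  assumes "subgroup W (add_monoid R)" "u \<in> carrier R"
  shows "v \<in> W #>\<^bsub>add_monoid R\<^esub> u \<longleftrightarrow> v \<in> carrier R \<and> v \<ominus> u \<in> W"
proof
  assume "v \<in> W #>\<^bsub>add_monoid R\<^esub> u"
  then obtain h where h: "h \<in> W" "v = h \<oplus> u" by (auto simp: r_coset_def)
  have "h \<in> carrier R" using h assms(1) by (auto dest: subgroup.mem_carrier)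
  then show "v \<in> carrier R \<and> v \<ominus> u \<in> W"
    using h assms(2) by (simp add: minus_eq a_assoc r_neg)
next
  assume v: "v \<in> carrier R \<and> v \<ominus> u \<in> W"
  then have "v = (v \<ominus> u) \<oplus> u" using assms(2) by (simp add: minus_eq a_assoc l_neg)
  with v show "v \<in> W #>\<^bsub>add_monoid R\<^esub> u" by (auto simp: r_coset_def)
qed

lemma verts_cay_graph [simp]: "verts (cay_graph R T) = carrier R"
  and arcs_ends_cay_graph [simp]: "arcs_ends (cay_graph R T) =
    {(x, y). x \<in> carrier R \<and> y \<in> carrier R \<and> x \<ominus> y \<in> T}"
  and arcs_cay_graph [simp]: "arcs (cay_graph R T) =
    {(x, y). x \<in> carrier R \<and> y \<in> carrier R \<and> x \<ominus> y \<in> T}"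
  and tail_cay_graph [simp]: "tail (cay_graph R T) = fst"
  and head_cay_graph [simp]: "head (cay_graph R T) = snd"
  by (simp_all add: cay_graph_def)

lemma sym_digraph_cay_graph:
  assumes "\<And>t. t \<in> T \<Longrightarrow> \<ominus> t \<in> T"
  shows "sym_digraph (cay_graph R T)"
proof unfold_locales
  show "symmetric (cay_graph R T)"
    unfolding symmetric_def
  proof (rule symI)
    fix x y assume "(x, y) \<in> arcs_ends (cay_graph R T)"
    then have xy: "x \<in> carrier R" "y \<in> carrier R" "x \<ominus> y \<in> T" by auto
    then show "(y, x) \<in> arcs_ends (cay_graph R T)"
      using assms[of "x \<ominus> y"] by (simp add: minus_diff_eq)
  qed
qed auto

lemma graph_cay_graph:
  assumes "finite (carrier R)" "\<zero> \<notin> T" "\<And>t. t \<in> T \<Longrightarrow> \<ominus> t \<in> T"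
  shows "graph (cay_graph R T)"
proof -
  interpret sym_digraph "cay_graph R T" using assms(3) by (rule sym_digraph_cay_graph)
  have "arcs (cay_graph R T) \<subseteq> carrier R \<times> carrier R" by auto
  then have "finite (arcs (cay_graph R T))" using assms(1) finite_subset by blast
  then show ?thesis
    using assms by unfold_locales (auto simp: arc_to_ends_def minus_eq r_neg)
qed

text \<open>Along an arc the vertex changes by an element of -T, which lies in T, so a walk stays in
  a coset of the span. Conversely, an expression of h by generators is read as a walk.\<close>

lemma reachable_cay_graph:
  assumes T: "T \<subseteq> carrier R" "\<And>t. t \<in> T \<Longrightarrow> \<ominus> t \<in> T" and u: "u \<in> carrier R"
  shows "u \<rightarrow>\<^sup>*\<^bsub>cay_graph R T\<^esub> v \<longleftrightarrow> v \<in> generate (add_monoid R) T #>\<^bsub>add_monoid R\<^esub> u"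
proof -
  let ?W = "generate (add_monoid R) T"
  interpret G: sym_digraph "cay_graph R T" using T(2) by (rule sym_digraph_cay_graph)
  have W: "subgroup ?W (add_monoid R)" using T(1) by (intro add.generate_is_subgroup) simp
  have dir: "v \<in> carrier R \<and> v \<ominus> u \<in> ?W" if "u \<rightarrow>\<^sup>*\<^bsub>cay_graph R T\<^esub> v"
    using that
  proof (induction rule: G.reachable_induct)
    case base
    then show ?case using W u by (simp add: minus_eq r_neg generate.one[of "add_monoid R", simplified])
  next
    case (step x y)
    then have xy: "x \<in> carrier R" "y \<in> carrier R" "x \<ominus> y \<in> T" "x \<ominus> u \<in> ?W" by auto
    have "y \<ominus> x \<in> ?W"
      using T(2)[OF xy(3)] xy by (intro generate.incl) (simp add: minus_diff_eq)
    then have "(y \<ominus> x) \<oplus> (x \<ominus> u) \<in> ?W"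
      using xy(4) subgroup.m_closed[OF W] by simp
    then show ?case using xy u by (simp add: diff_add_diff)
  qed
  \<comment> \<open>The walk descends from h + x to x because an arc (x, y) means that x - y lies in
    T. Keeping x arbitrary lets the walks for h1 (started at h1 + (h2 + x)) and h2 be concatenated;
    symmetry reverses the direction at the end.\<close>
  have inv: "(h \<oplus> x) \<rightarrow>\<^sup>*\<^bsub>cay_graph R T\<^esub> x" if "h \<in> ?W" "x \<in> carrier R" for h x
    using that
  proof (induction arbitrary: x rule: generate.induct)
    case one
    then show ?case by auto
  next
    case (incl h)
    then have "(h \<oplus> x) \<rightarrow>\<^bsub>cay_graph R T\<^esub> x"
      using T(1) by (auto simp: minus_eq a_assoc r_neg)
    then show ?case by (rule G.reachable_adjI)
  next
    case (inv h)
    then have "\<ominus> h \<in> T" "h \<in> carrier R" using T by auto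
    then have "(\<ominus> h \<oplus> x) \<rightarrow>\<^bsub>cay_graph R T\<^esub> x"
      using inv.prems by (auto simp: minus_eq a_assoc r_neg)
    then show ?case by (simp add: a_inv_def[symmetric] G.reachable_adjI)
  next
    case (eng h1 h2)
    have "h1 \<in> carrier R" "h2 \<in> carrier R"
      using eng.hyps W by (auto dest: subgroup.mem_carrier)
    then show ?case
      using eng.IH(1)[of "h2 \<oplus> x"] eng.IH(2)[of x] eng.prems
      by (auto simp: a_assoc intro: G.reachable_trans)
  qed
  show ?thesis
  proof
    assume "u \<rightarrow>\<^sup>*\<^bsub>cay_graph R T\<^esub> v"
    then show "v \<in> ?W #>\<^bsub>add_monoid R\<^esub> u" using dir W u by (simp add: mem_add_r_coset)
  next
    assume "v \<in> ?W #>\<^bsub>add_monoid R\<^esub> u"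
    then obtain h where "h \<in> ?W" "v = h \<oplus> u" by (auto simp: r_coset_def)
    then have "v \<rightarrow>\<^sup>*\<^bsub>cay_graph R T\<^esub> u" using inv u by simp
    then show "u \<rightarrow>\<^sup>*\<^bsub>cay_graph R T\<^esub> v" by (rule symmetric_reachable[OF G.sym_arcs])
  qed
qed

lemma connected_cay_graph_iff:
  assumes T: "T \<subseteq> carrier R" "\<And>t. t \<in> T \<Longrightarrow> \<ominus> t \<in> T"
  shows "Digraph_Component.connected (cay_graph R T) \<longleftrightarrow>
    generate (add_monoid R) T = carrier R"
proof -
  let ?W = "generate (add_monoid R) T"
  interpret G: sym_digraph "cay_graph R T" using T(2) by (rule sym_digraph_cay_graph)
  have W: "subgroup ?W (add_monoid R)" using T(1) by (intro add.generate_is_subgroup) simp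
  have sub: "?W \<subseteq> carrier R" using subgroup.subset[OF W] by simp
  have "strongly_connected (cay_graph R T) \<longleftrightarrow> ?W = carrier R"
  proof
    assume "strongly_connected (cay_graph R T)"
    then have "\<zero> \<rightarrow>\<^sup>*\<^bsub>cay_graph R T\<^esub> v" if "v \<in> carrier R" for v
      using that by (auto simp: strongly_connected_def)
    then have "v \<in> ?W" if "v \<in> carrier R" for v
      using that T W by (simp add: reachable_cay_graph mem_add_r_coset minus_eq)
    then show "?W = carrier R" using sub by blast
  next
    assume "?W = carrier R"
    then show "strongly_connected (cay_graph R T)"
      using T W by (auto simp: strongly_connected_def reachable_cay_graph mem_add_r_coset)
  qed
  then show ?thesis by (simp add: G.connected_iff_strongly_connected)
qed

lemma components_cay_graph:
  assumes T: "T \<subseteq> carrier R" "\<And>t. t \<in> T \<Longrightarrow> \<ominus> t \<in> T"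
  shows "components (cay_graph R T) =
    (\<lambda>A. cay_graph R T \<restriction> A) ` (rcosets\<^bsub>add_monoid R\<^esub> generate (add_monoid R) T)"
proof -
  interpret G: sym_digraph "cay_graph R T" using T(2) by (rule sym_digraph_cay_graph)
  have "(\<lambda>u. cay_graph R T \<restriction> {v. u \<rightarrow>\<^sup>*\<^bsub>cay_graph R T\<^esub> v}) ` carrier R =
      (\<lambda>u. cay_graph R T \<restriction> (generate (add_monoid R) T #>\<^bsub>add_monoid R\<^esub> u)) ` carrier R"
    using T by (intro image_cong) (simp_all add: reachable_cay_graph)
  then show ?thesis
    by (auto simp: G.components_eq_reachable RCOSETS_def)
qed

text \<open>Translations preserve differences, hence adjacency, and carry each coset of the span to
  any other. Arcs are pairs of vertices, so the image keeps the projections as tail and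
  head.\<close>

definition translation :: "'a \<Rightarrow> ('a, 'a \<times> 'a, 'a, 'a \<times> 'a) digraph_isomorphism" where
  "translation d = \<lparr>iso_verts = (\<lambda>x. x \<oplus> d), iso_arcs = (\<lambda>(x, y). (x \<oplus> d, y \<oplus> d)),
     iso_head = snd, iso_tail = fst\<rparr>"

lemma translation_cay_graph:
  assumes d: "d \<in> carrier R" and A: "A \<subseteq> carrier R"
  shows "pre_digraph.digraph_isomorphism (cay_graph R T \<restriction> A) (translation d)"
    and "app_iso (translation d) (cay_graph R T \<restriction> A) =
      cay_graph R T \<restriction> ((\<lambda>x. x \<oplus> d) ` A)"
proof -
  have wf: "wf_digraph (cay_graph R T)" by unfold_locales auto
  show "pre_digraph.digraph_isomorphism (cay_graph R T \<restriction> A) (translation d)"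
    unfolding pre_digraph.digraph_isomorphism_def translation_def
    using wf_digraph.wellformed_induce_subgraph[OF wf] d A
    by (auto simp: inj_on_def subset_eq)
  have "arcs (cay_graph R T \<restriction> ((\<lambda>x. x \<oplus> d) ` A)) =
      (\<lambda>(x, y). (x \<oplus> d, y \<oplus> d)) ` arcs (cay_graph R T \<restriction> A)"
    (is "?L = ?R")
  proof
    show "?L \<subseteq> ?R"
    proof
      fix e assume "e \<in> ?L"
      then obtain x y where "x \<in> A" "y \<in> A" "e = (x \<oplus> d, y \<oplus> d)" "(x \<oplus> d) \<ominus> (y \<oplus> d) \<in> T"
        by auto
      moreover from this have "x \<in> carrier R" "y \<in> carrier R" using A by auto
      ultimately show "e \<in> ?R"
        using d by (intro image_eqI[of _ _ "(x, y)"]) (auto simp: add_diff_add_right)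
    qed
    show "?R \<subseteq> ?L" using d A by (auto simp: add_diff_add_right)
  qed
  then show "app_iso (translation d) (cay_graph R T \<restriction> A) =
      cay_graph R T \<restriction> ((\<lambda>x. x \<oplus> d) ` A)"
    by (intro pre_digraph.equality) (simp_all add: translation_def)
qed

end


section \<open>Automorphisms of a disjoint union of isomorphic connected graphs\<close>

text \<open>The carrier of \<open>aut_group\<close> in terms of a vertex set and an adjacency
  relation, so that the wreath product argument can be carried out without digraph records.\<close>

definition graph_autos :: "'a set \<Rightarrow> 'a rel \<Rightarrow> ('a \<Rightarrow> 'a) set" where
  "graph_autos V A = {f \<in> Bij V. \<forall>u\<in>V. \<forall>v\<in>V. (u, v) \<in> A \<longleftrightarrow> (f u, f v) \<in> A}"

lemma graph_autosI:
  assumes "finite V" "f \<in> extensional V" "inj_on f V" "f ` V \<subseteq> V"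
    and "\<And>u v. u \<in> V \<Longrightarrow> v \<in> V \<Longrightarrow> (u, v) \<in> A \<longleftrightarrow> (f u, f v) \<in> A"
  shows "f \<in> graph_autos V A"
  using assms endo_inj_surj[of V f] by (auto simp: graph_autos_def Bij_def bij_betw_def)

lemma carrier_aut_group: "carrier (aut_group G) = graph_autos (verts G) (arcs_ends G)"
  by (simp add: aut_group_def graph_autos_def)

lemma mult_aut_group:
  assumes "f \<in> carrier (aut_group G)" "g \<in> carrier (aut_group G)"
  shows "f \<otimes>\<^bsub>aut_group G\<^esub> g = compose (verts G) f g"
  using assms by (simp add: aut_group_def BijGroup_def)

text \<open>A disjoint union of \<open>b\<close> copies of a connected graph. The value
  \<open>\<theta> (i, x)\<close> stands for \<open>iso_verts (\<Phi> i) x\<close>, the point x of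
  the i-th component.\<close>

locale component_coordinates =
  fixes V V0 :: "'a set" and A A0 :: "'a rel" and b :: nat and \<theta> :: "nat \<times> 'a \<Rightarrow> 'a"
  assumes bij: "bij_betw \<theta> ({1..b} \<times> V0) V"
    and finite_V0: "finite V0"
    and nonempty_V0: "V0 \<noteq> {}"
    and connected_V0: "x \<in> V0 \<Longrightarrow> y \<in> V0 \<Longrightarrow> (x, y) \<in> A0\<^sup>*"
    and arcs_V0: "A0 \<subseteq> V0 \<times> V0"
    and adj: "i \<in> {1..b} \<Longrightarrow> j \<in> {1..b} \<Longrightarrow> x \<in> V0 \<Longrightarrow> y \<in> V0 \<Longrightarrow>
      (\<theta> (i, x), \<theta> (j, y)) \<in> A \<longleftrightarrow> i = j \<and> (x, y) \<in> A0"
begin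

text \<open>This is \<open>wreath_action\<close> in coordinates. The entries of \<open>f\<close> are
  indexed by the copy in which a vertex arrives, not by the one that it leaves.\<close>

definition act :: "(nat \<Rightarrow> 'a \<Rightarrow> 'a) \<times> (nat \<Rightarrow> nat) \<Rightarrow> 'a \<Rightarrow> 'a" where
  "act = (\<lambda>(f, \<sigma>). \<lambda>v\<in>V. case inv_into ({1..b} \<times> V0) \<theta> v of (i, x) \<Rightarrow> \<theta> (\<sigma> i, f (\<sigma> i) x))"

definition wreath_set :: "((nat \<Rightarrow> 'a \<Rightarrow> 'a) \<times> (nat \<Rightarrow> nat)) set" where
  "wreath_set = (\<Pi>\<^sub>E i\<in>{1..b}. graph_autos V0 A0) \<times> {\<sigma>. \<sigma> permutes {1..b}}"

lemma finite_V: "finite V"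
  using bij finite_V0 by (metis bij_betw_finite finite_SigmaI finite_atLeastAtMost)

lemma theta_mem: "i \<in> {1..b} \<Longrightarrow> x \<in> V0 \<Longrightarrow> \<theta> (i, x) \<in> V"
  using bij by (auto simp: bij_betw_def)

lemma theta_inj:
  assumes "i \<in> {1..b}" "j \<in> {1..b}" "x \<in> V0" "y \<in> V0"
  shows "\<theta> (i, x) = \<theta> (j, y) \<longleftrightarrow> i = j \<and> x = y"
  using assms inj_on_eq_iff[OF bij_betw_imp_inj_on[OF bij], of "(i, x)" "(j, y)"] by simp

lemma theta_cases:
  assumes "v \<in> V"
  obtains i x where "i \<in> {1..b}" "x \<in> V0" "v = \<theta> (i, x)"
  using assms bij unfolding bij_betw_def by blast

lemma act_theta:
  assumes "i \<in> {1..b}" "x \<in> V0"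
  shows "act (f, \<sigma>) (\<theta> (i, x)) = \<theta> (\<sigma> i, f (\<sigma> i) x)"
proof -
  have "inv_into ({1..b} \<times> V0) \<theta> (\<theta> (i, x)) = (i, x)"
    using assms bij_betw_imp_inj_on[OF bij] by (intro inv_into_f_f) auto
  then show ?thesis using theta_mem[OF assms] by (simp add: act_def)
qed

lemma act_extensional: "act w \<in> extensional V"
  by (auto simp: act_def split: prod.split)

lemma wreath_setD:
  assumes "(f, \<sigma>) \<in> wreath_set" "i \<in> {1..b}"
  shows "\<sigma> i \<in> {1..b}" "f i \<in> graph_autos V0 A0" "f i \<in> Bij V0" "inj_on (f i) V0"
    and "x \<in> V0 \<Longrightarrow> f i x \<in> V0"
    and "\<sigma> permutes {1..b}"
proof -
  show "\<sigma> permutes {1..b}" using assms(1) by (simp add: wreath_set_def)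
  then show "\<sigma> i \<in> {1..b}" using assms(2) by (simp only: permutes_in_image)
  show f: "f i \<in> graph_autos V0 A0" using assms by (auto simp: wreath_set_def)
  then show "f i \<in> Bij V0" by (simp add: graph_autos_def)
  then show "inj_on (f i) V0" "x \<in> V0 \<Longrightarrow> f i x \<in> V0" by (auto simp: Bij_def bij_betw_def)
qed

lemma act_mem:
  assumes w: "(f, \<sigma>) \<in> wreath_set"
  shows "act (f, \<sigma>) \<in> graph_autos V A"
proof (rule graph_autosI[OF finite_V act_extensional])
  note D = wreath_setD[OF w]
  have \<sigma>: "\<sigma> i = \<sigma> j \<longleftrightarrow> i = j" for i j
    using w by (simp add: wreath_set_def) (metis permutes_inj injD)
  show "inj_on (act (f, \<sigma>)) V"
  proof (rule inj_onI)
    fix u v assume uv: "u \<in> V" "v \<in> V" "act (f, \<sigma>) u = act (f, \<sigma>) v"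
    obtain i x where u: "i \<in> {1..b}" "x \<in> V0" "u = \<theta> (i, x)" using uv(1) by (rule theta_cases)
    obtain j y where v: "j \<in> {1..b}" "y \<in> V0" "v = \<theta> (j, y)" using uv(2) by (rule theta_cases)
    have eq: "\<theta> (\<sigma> i, f (\<sigma> i) x) = \<theta> (\<sigma> j, f (\<sigma> j) y)"
      using uv(3) u v by (simp add: act_theta)
    have \<sigma>i: "\<sigma> i \<in> {1..b}" "\<sigma> j \<in> {1..b}" using D(1) u(1) v(1) by blast+
    have "\<sigma> i = \<sigma> j \<and> f (\<sigma> i) x = f (\<sigma> j) y"
      using eq theta_inj[OF \<sigma>i D(5)[OF \<sigma>i(1) u(2)] D(5)[OF \<sigma>i(2) v(2)]] by blast
    then show "u = v" using u v D(4)[OF \<sigma>i(1)] \<sigma> by (metis inj_onD)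
  qed
  show "act (f, \<sigma>) ` V \<subseteq> V"
  proof
    fix u assume "u \<in> act (f, \<sigma>) ` V"
    then obtain v where v: "v \<in> V" "u = act (f, \<sigma>) v" by blast
    obtain i x where "i \<in> {1..b}" "x \<in> V0" "v = \<theta> (i, x)" using v(1) by (rule theta_cases)
    with v show "u \<in> V" using D by (simp add: act_theta theta_mem)
  qed
  fix u v assume uv: "u \<in> V" "v \<in> V"
  obtain i x where u: "i \<in> {1..b}" "x \<in> V0" "u = \<theta> (i, x)" using uv(1) by (rule theta_cases)
  obtain j y where v: "j \<in> {1..b}" "y \<in> V0" "v = \<theta> (j, y)" using uv(2) by (rule theta_cases)
  have "(x, y) \<in> A0 \<longleftrightarrow> (f (\<sigma> i) x, f (\<sigma> i) y) \<in> A0"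
    using D(2)[OF D(1)[OF u(1)]] u(2) v(2) by (simp add: graph_autos_def)
  then show "(u, v) \<in> A \<longleftrightarrow> (act (f, \<sigma>) u, act (f, \<sigma>) v) \<in> A"
    using u v D by (auto simp: act_theta adj \<sigma>)
qed

lemma inj_on_act: "inj_on act wreath_set"
proof (rule inj_onI, safe)
  fix f \<sigma> g \<tau>
  assume w: "(f, \<sigma>) \<in> wreath_set" "(g, \<tau>) \<in> wreath_set" and eq: "act (f, \<sigma>) = act (g, \<tau>)"
  note D = wreath_setD[OF w(1)] and E = wreath_setD[OF w(2)]
  have *: "\<sigma> i = \<tau> i \<and> f (\<sigma> i) x = g (\<sigma> i) x" if "i \<in> {1..b}" "x \<in> V0" for i x
  proof -
    have "\<theta> (\<sigma> i, f (\<sigma> i) x) = \<theta> (\<tau> i, g (\<tau> i) x)"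
      using eq that act_theta by metis
    then show ?thesis using that D E by (auto simp: theta_inj)
  qed
  have p: "\<sigma> permutes {1..b}" "\<tau> permutes {1..b}" using w by (auto simp: wreath_set_def)
  show "\<sigma> = \<tau>"
  proof
    \<comment> \<open>Inside the range a point of V0 is needed to observe where copy i goes;
      outside, both permutations fix i.\<close>
    fix i show "\<sigma> i = \<tau> i"
      using * nonempty_V0 p by (cases "i \<in> {1..b}") (auto simp: permutes_not_in)
  qed
  show "f = g"
  proof (rule extensionalityI[of _ "{1..b}"])
    show "f \<in> extensional {1..b}" "g \<in> extensional {1..b}"
      using w by (auto simp: wreath_set_def PiE_def)
    fix j assume j: "j \<in> {1..b}"
    \<comment> \<open>The action reveals \<open>f\<close> only at indices \<open>\<sigma> i\<close>;
      surjectivity of \<sigma> reaches every j.\<close>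
    then obtain i where i: "i \<in> {1..b}" "j = \<sigma> i"
      using permutes_image[OF p(1)] by blast
    show "f j = g j"
    proof (rule extensionalityI[of _ V0])
      show "f j \<in> extensional V0" "g j \<in> extensional V0"
        using D(3)[OF j] E(3)[OF j] by (auto intro: Bij_imp_extensional)
      show "f j x = g j x" if "x \<in> V0" for x using *[OF i(1) that] i(2) by metis
    qed
  qed
qed

text \<open>
  An automorphism maps adjacent vertices into one component, so by connectedness it permutes
  the components.
\<close>

lemma act_surj:
  assumes h: "h \<in> graph_autos V A"
  obtains f \<sigma> where "(f, \<sigma>) \<in> wreath_set" "act (f, \<sigma>) = h"
proof -
  have hB: "h ` V = V" "inj_on h V" "h \<in> extensional V"
    using h by (auto simp: graph_autos_def Bij_def bij_betw_def)
  have "\<exists>p. p \<in> {1..b} \<times> V0 \<and> \<theta> p = h (\<theta> (i, x))" if "i \<in> {1..b}" "x \<in> V0" for i x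
  proof -
    have "h (\<theta> (i, x)) \<in> V" using theta_mem[OF that] hB(1) by blast
    then obtain j y where "j \<in> {1..b}" "y \<in> V0" "h (\<theta> (i, x)) = \<theta> (j, y)"
      by (rule theta_cases)
    then show ?thesis by (intro exI[of _ "(j, y)"]) simp
  qed
  then have "\<forall>i x. \<exists>p. i \<in> {1..b} \<longrightarrow> x \<in> V0 \<longrightarrow> p \<in> {1..b} \<times> V0 \<and> \<theta> p = h (\<theta> (i, x))"
    by blast
  then obtain p where p: "p i x \<in> {1..b} \<times> V0" "\<theta> (p i x) = h (\<theta> (i, x))"
    if "i \<in> {1..b}" "x \<in> V0" for i x
    by metis
  define c where "c i x = fst (p i x)" for i x
  define d where "d i x = snd (p i x)" for i x
  have cd: "c i x \<in> {1..b}" "d i x \<in> V0" "h (\<theta> (i, x)) = \<theta> (c i x, d i x)"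
    if "i \<in> {1..b}" "x \<in> V0" for i x
    using p[OF that] by (auto simp: c_def d_def mem_Times_iff)
  have adj_cd: "c i x = c i y \<and> (d i x, d i y) \<in> A0 \<longleftrightarrow> (x, y) \<in> A0"
    if "i \<in> {1..b}" "x \<in> V0" "y \<in> V0" for i x y
  proof -
    have "(\<theta> (i, x), \<theta> (i, y)) \<in> A \<longleftrightarrow> (h (\<theta> (i, x)), h (\<theta> (i, y))) \<in> A"
      using h theta_mem that by (simp add: graph_autos_def)
    then show ?thesis using that cd by (simp add: adj)
  qed
  obtain z where z: "z \<in> V0" using nonempty_V0 by blast
  have const: "c i x = c i z" if i: "i \<in> {1..b}" and x: "x \<in> V0" for i x
  proof -
    have "c i x = c i z" using connected_V0[OF z x]
    proof (induction rule: rtrancl_induct)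
      case (step u v)
      then show ?case using adj_cd[OF i, of u v] arcs_V0 by auto
    qed simp
    then show ?thesis .
  qed
  \<comment> \<open>By \<open>const\<close> the base point z could be any vertex of V0. The identity
    outside the range is what \<open>permutes\<close> demands.\<close>
  define \<sigma> where "\<sigma> i = (if i \<in> {1..b} then c i z else i)" for i
  have h_theta: "h (\<theta> (i, x)) = \<theta> (\<sigma> i, d i x)" if "i \<in> {1..b}" "x \<in> V0" for i x
    using cd[OF that] const[OF that] that by (simp add: \<sigma>_def)
  have "{1..b} \<subseteq> \<sigma> ` {1..b}"
  proof
    fix j assume j: "j \<in> {1..b}"
    then have "\<theta> (j, z) \<in> h ` V" using theta_mem z hB(1) by simp
    then obtain v where v: "v \<in> V" "h v = \<theta> (j, z)" by auto
    obtain i x where i: "i \<in> {1..b}" "x \<in> V0" "v = \<theta> (i, x)" using v(1) by (rule theta_cases)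
    then have "\<sigma> i = j"
      using v(2) h_theta[of i x] j z cd[of i x] cd(1)[OF i(1) z] by (simp add: theta_inj \<sigma>_def)
    then show "j \<in> \<sigma> ` {1..b}" using i(1) by blast
  qed
  moreover have "\<sigma> ` {1..b} \<subseteq> {1..b}" using cd(1)[OF _ z] by (auto simp: \<sigma>_def)
  ultimately have img: "\<sigma> ` {1..b} = {1..b}" by blast
  then have "inj_on \<sigma> {1..b}" by (simp add: eq_card_imp_inj_on)
  then have "bij_betw \<sigma> {1..b} {1..b}" using img by (simp add: bij_betw_def)
  then have perm: "\<sigma> permutes {1..b}" by (rule bij_imp_permutes) (auto simp: \<sigma>_def)
  \<comment> \<open>The entry at j acts on arrival in copy j, so it is read off from h on the copy
    that \<sigma> sends to j.\<close>
  define f where "f = (\<lambda>j\<in>{1..b}. \<lambda>x\<in>V0. d (inv' \<sigma> j) x)"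
  have f_mem: "f j \<in> graph_autos V0 A0" if j: "j \<in> {1..b}" for j
  proof (rule graph_autosI[OF finite_V0])
    obtain i where i: "i \<in> {1..b}" "j = \<sigma> i" using img j by blast
    have fj: "f j x = d i x" if "x \<in> V0" for x
      using that j i permutes_inverses(2)[OF perm] by (simp add: f_def)
    show "f j \<in> extensional V0" using j by (simp add: f_def)
    show "inj_on (f j) V0"
    proof (rule inj_onI)
      fix x y assume xy: "x \<in> V0" "y \<in> V0" "f j x = f j y"
      then have "h (\<theta> (i, x)) = h (\<theta> (i, y))" using fj h_theta i by simp
      then have "\<theta> (i, x) = \<theta> (i, y)" using hB(2) theta_mem i xy by (meson inj_onD)
      then show "x = y" using xy i by (simp add: theta_inj)
    qed
    show "f j ` V0 \<subseteq> V0" using fj cd i by auto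
    show "(x, y) \<in> A0 \<longleftrightarrow> (f j x, f j y) \<in> A0" if "x \<in> V0" "y \<in> V0" for x y
      using adj_cd[OF i(1) that] const[OF i(1)] that fj by simp
  qed
  have mem: "(f, \<sigma>) \<in> wreath_set"
    using f_mem perm by (auto simp: wreath_set_def f_def PiE_def)
  have "act (f, \<sigma>) = h"
  proof (rule extensionalityI[OF act_extensional hB(3)])
    fix v assume "v \<in> V"
    then obtain i x where i: "i \<in> {1..b}" "x \<in> V0" "v = \<theta> (i, x)" by (rule theta_cases)
    have "\<sigma> i \<in> {1..b}" using img i(1) by blast
    then have "f (\<sigma> i) x = d i x"
      using i permutes_inverses(2)[OF perm] by (simp add: f_def)
    then show "act (f, \<sigma>) v = h v" using i h_theta by (simp add: act_theta)
  qed
  with mem show thesis by (rule that)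
qed

lemma bij_betw_act: "bij_betw act wreath_set (graph_autos V A)"
  unfolding bij_betw_def
proof (intro conjI inj_on_act equalityI subsetI)
  fix h assume "h \<in> act ` wreath_set"
  then show "h \<in> graph_autos V A" using act_mem by auto
next
  fix h assume "h \<in> graph_autos V A"
  then show "h \<in> act ` wreath_set" by (rule act_surj) blast
qed

text \<open>The vertex (i, x) goes to copy \<tau> i and then to j = \<sigma> (\<tau> i), where the
  entry \<open>g (\<tau> i)\<close> has acted before \<open>f j\<close>. Indexed by the final copy
  j, the inner entry is \<open>g (inv' \<sigma> j)\<close>, which is the twist in the semidirect
  product.\<close>

lemma act_compose:
  assumes w: "(f, \<sigma>) \<in> wreath_set" "(g, \<tau>) \<in> wreath_set"
  shows "act (\<lambda>i\<in>{1..b}. compose V0 (f i) (g (inv' \<sigma> i)), \<sigma> \<circ> \<tau>) =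
    compose V (act (f, \<sigma>)) (act (g, \<tau>))"
proof (rule extensionalityI[OF act_extensional])
  show "compose V (act (f, \<sigma>)) (act (g, \<tau>)) \<in> extensional V" by (simp add: compose_def)
  note D = wreath_setD[OF w(1)] and E = wreath_setD[OF w(2)]
  fix v assume v: "v \<in> V"
  then obtain i x where i: "i \<in> {1..b}" "x \<in> V0" "v = \<theta> (i, x)" by (rule theta_cases)
  have "inv' \<sigma> (\<sigma> (\<tau> i)) = \<tau> i" using permutes_inverses(2)[OF D(6)[OF i(1)]] .
  then show "act (\<lambda>i\<in>{1..b}. compose V0 (f i) (g (inv' \<sigma> i)), \<sigma> \<circ> \<tau>) v =
    compose V (act (f, \<sigma>)) (act (g, \<tau>)) v"
    using i v D(1)[OF E(1)[OF i(1)]] E(1)[OF i(1)] E(5)[OF E(1)[OF i(1)] i(2)]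
    by (simp add: compose_eq act_theta)
qed

end

text \<open>The labels (i, x) are coordinates: components are disjoint (injectivity), cover all
  vertices (surjectivity), and are induced subgraphs without arcs between them (adjacency). The rest
  is the abstract argument for \<open>component_coordinates\<close>.\<close>

lemma (in sym_digraph) wreath_action_iso:
  assumes fin: "finite (verts G)" and G0: "G0 \<in> components G"
    and \<Phi>: "component_identification G G0 b \<Phi>"
  shows "wreath_action G G0 b \<Phi> \<in> iso (wreath_sym (aut_group G0) b) (aut_group G)"
proof -
  define C where "C i = app_iso (\<Phi> i) G0" for i
  define \<theta> where "\<theta> = (\<lambda>(i, x). iso_verts (\<Phi> i) x)"
  have hom: "pre_digraph.digraph_isomorphism G0 (\<Phi> i)" if "i \<in> {1..b}" for i
    using \<Phi> that by (simp add: component_identification_def)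
  have C: "bij_betw C {1..b} sccs"
    using \<Phi> by (simp add: component_identification_def components_eq_sccs C_def[abs_def])
  have CD: "C i \<in> sccs" if "i \<in> {1..b}" for i using C that by (auto simp: bij_betw_def)
  have vC: "verts (C i) = (\<lambda>x. \<theta> (i, x)) ` verts G0" for i by (simp add: C_def \<theta>_def)
  have G0s: "G0 \<in> sccs" using G0 by (simp add: components_eq_sccs)
  have V0: "verts G0 \<subseteq> verts G" using G0s by (auto simp: sccs_def)
  have sc: "strongly_connected G0" using G0s by (simp add: sccs_def)
  interpret G0: wf_digraph G0 using G0s by (auto simp: sccs_def)
  have inj: "inj_on \<theta> ({1..b} \<times> verts G0)"
  proof (rule inj_onI, clarify)
    fix i x j y
    assume i: "i \<in> {1..b}" "j \<in> {1..b}" "x \<in> verts G0" "y \<in> verts G0" and eq: "\<theta> (i, x) = \<theta> (j, y)"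
    have "\<theta> (i, x) \<in> verts (C i)" "\<theta> (j, y) \<in> verts (C j)" using i by (simp_all add: vC)
    then have "C i = C j" using eq scc_disj CD i by (metis disjoint_iff)
    then have "i = j" using C i by (meson bij_betw_imp_inj_on inj_onD)
    moreover have "x = y"
      using eq i G0.digraph_isomorphism_inj_on_verts[OF hom[OF i(1)]] \<open>i = j\<close>
      by (simp add: \<theta>_def inj_on_def)
    ultimately show "i = j \<and> x = y" by blast
  qed
  have img: "\<theta> ` ({1..b} \<times> verts G0) = verts G"
  proof
    show "\<theta> ` ({1..b} \<times> verts G0) \<subseteq> verts G"
      using CD vC by (fastforce simp: sccs_def)
    show "verts G \<subseteq> \<theta> ` ({1..b} \<times> verts G0)"
    proof
      fix v assume "v \<in> verts G"
      then obtain c where "c \<in> sccs" "v \<in> verts c" using scc_for_vert_ex by blast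
      then obtain i where "i \<in> {1..b}" "v \<in> verts (C i)"
        using bij_betw_imp_surj_on[OF C] by (metis imageE)
      then show "v \<in> \<theta> ` ({1..b} \<times> verts G0)" using vC by auto
    qed
  qed
  have arcs_C: "arcs_ends (C i) = {(u, v) \<in> arcs_ends G. u \<in> verts (C i) \<and> v \<in> verts (C i)}"
    if "i \<in> {1..b}" for i
    using CD[OF that] by (force simp: sccs_def arcs_ends_conv compatible_def)
  have adj: "(\<theta> (i, x), \<theta> (j, y)) \<in> arcs_ends G \<longleftrightarrow> i = j \<and> (x, y) \<in> arcs_ends G0"
    if i: "i \<in> {1..b}" "j \<in> {1..b}" "x \<in> verts G0" "y \<in> verts G0" for i j x y
  proof -
    have vs: "\<theta> (i, x) \<in> verts (C i)" "\<theta> (j, y) \<in> verts (C j)" using i vC by auto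
    have same: "i = j" if "(\<theta> (i, x), \<theta> (j, y)) \<in> arcs_ends G"
    proof -
      \<comment> \<open>The end of an arc is reachable from its start, so both lie in one component,
        which must be \<open>C i\<close> as well as \<open>C j\<close>.\<close>
      let ?D = "G \<restriction> {v. \<theta> (i, x) \<rightarrow>\<^sup>* v}"
      have u: "\<theta> (i, x) \<in> verts G" using img i by auto
      then have "?D \<in> sccs" by (rule induce_reachable_is_in_sccs)
      moreover have "\<theta> (i, x) \<in> verts ?D" "\<theta> (j, y) \<in> verts ?D"
        using u that by auto
      ultimately have "C i = ?D" "C j = ?D" using vs CD i scc_disj by blast+
      then show "i = j" using C i by (metis bij_betw_imp_inj_on inj_onD)
    qed
    have "(\<theta> (i, x), \<theta> (i, y)) \<in> arcs_ends G \<longleftrightarrow> (x, y) \<in> arcs_ends G0"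
    proof -
      have image: "arcs_ends (C i) = (\<lambda>(u, v). (\<theta> (i, u), \<theta> (i, v))) ` arcs_ends G0"
        using G0.arcs_ends_app_iso_eq[OF hom[OF i(1)]] by (simp add: C_def \<theta>_def)
      have sub: "(\<theta> (i, x), \<theta> (i, y)) \<in> arcs_ends G \<longleftrightarrow> (\<theta> (i, x), \<theta> (i, y)) \<in> arcs_ends (C i)"
        using arcs_C[OF i(1)] vC i by auto
      have inj_i: "u = v" if "\<theta> (i, u) = \<theta> (i, v)" "u \<in> verts G0" "v \<in> verts G0" for u v
        using inj_onD[OF inj that(1)] i(1) that by simp
      show ?thesis
      proof
        assume "(\<theta> (i, x), \<theta> (i, y)) \<in> arcs_ends G"
        then obtain u v where uv: "(u, v) \<in> arcs_ends G0" "\<theta> (i, x) = \<theta> (i, u)" "\<theta> (i, y) = \<theta> (i, v)"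
          unfolding sub image by fast
        then have "x = u" "y = v" using inj_i G0.adj_in_verts[OF uv(1)] i by blast+
        with uv show "(x, y) \<in> arcs_ends G0" by simp
      next
        assume "(x, y) \<in> arcs_ends G0"
        then show "(\<theta> (i, x), \<theta> (i, y)) \<in> arcs_ends G" unfolding sub image by force
      qed
    qed
    then show ?thesis using same by blast
  qed
  interpret component_coordinates "verts G" "verts G0" "arcs_ends G" "arcs_ends G0" b \<theta>
  proof
    show "bij_betw \<theta> ({1..b} \<times> verts G0) (verts G)" using inj img by (simp add: bij_betw_def)
    show "finite (verts G0)" using V0 fin by (rule finite_subset)
    show "verts G0 \<noteq> {}" using sc by (simp add: strongly_connected_def)
    show "(x, y) \<in> (arcs_ends G0)\<^sup>*" if "x \<in> verts G0" "y \<in> verts G0" for x y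
      using sc that by (simp add: strongly_connected_def reachable_rtranclI)
    show "arcs_ends G0 \<subseteq> verts G0 \<times> verts G0" using G0.adj_in_verts by auto
  qed (use adj in auto)
  have act: "wreath_action G G0 b \<Phi> = act"
    unfolding wreath_action_def act_def unfolding \<theta>_def by simp
  have carr: "carrier (wreath_sym (aut_group G0) b) = wreath_set"
    by (simp add: wreath_sym_def wreath_set_def product_group_def sym_group_def carrier_aut_group)
  have mult: "(f, \<sigma>) \<otimes>\<^bsub>wreath_sym (aut_group G0) b\<^esub> (g, \<tau>) =
      (\<lambda>i\<in>{1..b}. compose (verts G0) (f i) (g (inv' \<sigma> i)), \<sigma> \<circ> \<tau>)"
    if w: "(f, \<sigma>) \<in> wreath_set" "(g, \<tau>) \<in> wreath_set" for f \<sigma> g \<tau>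
  proof -
    have "f i \<otimes>\<^bsub>aut_group G0\<^esub> g (inv' \<sigma> i) = compose (verts G0) (f i) (g (inv' \<sigma> i))"
      if "i \<in> {1..b}" for i
    proof (rule mult_aut_group)
      show "f i \<in> carrier (aut_group G0)"
        using wreath_setD(2)[OF w(1) that] by (simp add: carrier_aut_group)
      have "inv' \<sigma> i \<in> {1..b}"
        using wreath_setD(6)[OF w(1) that] that by (metis permutes_inv permutes_in_image)
      then show "g (inv' \<sigma> i) \<in> carrier (aut_group G0)"
        using wreath_setD(2)[OF w(2)] by (simp add: carrier_aut_group)
    qed
    then show ?thesis
      by (simp add: wreath_sym_def product_group_def sym_group_def cong: restrict_cong)
  qed
  show ?thesis
    unfolding act
  proof (rule isoI)
    show "act \<in> hom (wreath_sym (aut_group G0) b) (aut_group G)"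
    proof (rule homI)
      fix w assume "w \<in> carrier (wreath_sym (aut_group G0) b)"
      then show "act w \<in> carrier (aut_group G)"
        using act_mem by (cases w) (simp add: carr carrier_aut_group)
    next
      fix v w
      assume v: "v \<in> carrier (wreath_sym (aut_group G0) b)"
        and w: "w \<in> carrier (wreath_sym (aut_group G0) b)"
      obtain f \<sigma> g \<tau> where eq: "v = (f, \<sigma>)" "w = (g, \<tau>)" by (cases v, cases w)
      show "act (v \<otimes>\<^bsub>wreath_sym (aut_group G0) b\<^esub> w) = act v \<otimes>\<^bsub>aut_group G\<^esub> act w"
        using v w act_mem
        by (simp add: eq carr mult act_compose mult_aut_group carrier_aut_group del: One_nat_def)
    qed
    show "bij_betw act (carrier (wreath_sym (aut_group G0) b)) (carrier (aut_group G))"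
      using bij_betw_act by (simp add: carr carrier_aut_group)
  qed
qed


section \<open>The Frobenius map\<close>

text \<open>The binomial theorem with one summand equal to 1. In a field this case is enough, since
  a nonzero x can be factored out of x + y.\<close>

lemma (in cring) one_add_nat_pow:
  assumes x: "x \<in> carrier R"
  shows "(\<one> \<oplus> x) [^] (n::nat) = (\<Oplus>i\<in>{..n}. [(n choose i)] \<cdot> (x [^] i))"
proof (induction n)
  case 0
  then show ?case using x by simp
next
  case (Suc n)
  let ?t = "\<lambda>n i. [(n choose i)] \<cdot> (x [^] (i::nat))"
  have t: "?t m \<in> A \<rightarrow> carrier R" for m A using x by auto
  have t': "(\<lambda>i. ?t m (Suc i)) \<in> A \<rightarrow> carrier R" for m A using x by auto
  have t'': "(\<lambda>i. [(m choose i)] \<cdot> (x [^] Suc i)) \<in> A \<rightarrow> carrier R" for m A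
    using x by (auto simp del: nat_pow_Suc)
  \<comment> \<open>Splitting off the term of index 0 requires a sum up to a successor; the added
    top term vanishes because its binomial coefficient is 0. The shifted sum then meets the one in
    \<open>high\<close> term by term, for Pascal's rule.\<close>
  have low: "(\<Oplus>i\<in>{..n}. ?t n i) = (\<Oplus>i\<in>{..n}. ?t n (Suc i)) \<oplus> \<one>"
  proof -
    have "(\<Oplus>i\<in>{..Suc n}. ?t n i) = ?t n (Suc n) \<oplus> (\<Oplus>i\<in>{..n}. ?t n i)"
      by (rule finsum_Suc[OF t])
    then have "(\<Oplus>i\<in>{..n}. ?t n i) = (\<Oplus>i\<in>{..Suc n}. ?t n i)"
      using x finsum_closed[OF t] by (simp add: binomial_eq_0)
    also have "\<dots> = (\<Oplus>i\<in>{..n}. ?t n (Suc i)) \<oplus> ?t n 0" by (rule finsum_Suc2[OF t])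
    finally show ?thesis by simp
  qed
  have high: "x \<otimes> (\<Oplus>i\<in>{..n}. ?t n i) = (\<Oplus>i\<in>{..n}. [(n choose i)] \<cdot> (x [^] Suc i))"
  proof -
    have "x \<otimes> (\<Oplus>i\<in>{..n}. ?t n i) = (\<Oplus>i\<in>{..n}. x \<otimes> ?t n i)"
      using x t by (intro finsum_rdistr) auto
    also have "\<dots> = (\<Oplus>i\<in>{..n}. [(n choose i)] \<cdot> (x [^] Suc i))"
      using x by (intro finsum_cong') (auto simp: add_pow_rdistr m_comm)
    finally show ?thesis .
  qed
  have "(\<one> \<oplus> x) [^] Suc n = (\<one> \<oplus> x) \<otimes> (\<Oplus>i\<in>{..n}. ?t n i)"
    using Suc x by (simp add: m_comm)
  also have "\<dots> = (\<Oplus>i\<in>{..n}. ?t n i) \<oplus> x \<otimes> (\<Oplus>i\<in>{..n}. ?t n i)"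
    using x finsum_closed[OF t] by (simp add: l_distr)
  also have "\<dots> = ((\<Oplus>i\<in>{..n}. ?t n (Suc i)) \<oplus> \<one>) \<oplus>
      (\<Oplus>i\<in>{..n}. [(n choose i)] \<cdot> (x [^] Suc i))"
    unfolding high by (subst low) (rule refl)
  also have "\<dots> = ((\<Oplus>i\<in>{..n}. [(n choose i)] \<cdot> (x [^] Suc i)) \<oplus> (\<Oplus>i\<in>{..n}. ?t n (Suc i))) \<oplus> \<one>"
    using finsum_closed[OF t'] finsum_closed[OF t''] by (simp add: a_ac)
  also have "(\<Oplus>i\<in>{..n}. [(n choose i)] \<cdot> (x [^] Suc i)) \<oplus> (\<Oplus>i\<in>{..n}. ?t n (Suc i)) =
      (\<Oplus>i\<in>{..n}. [(n choose i)] \<cdot> (x [^] Suc i) \<oplus> ?t n (Suc i))"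
    by (rule finsum_addf[OF t'' t', symmetric])
  also have "\<dots> = (\<Oplus>i\<in>{..n}. ?t (Suc n) (Suc i))"
    using x by (intro finsum_cong') (auto simp: add.nat_pow_mult simp del: nat_pow_Suc)
  also have "\<dots> \<oplus> \<one> = (\<Oplus>i\<in>{..Suc n}. ?t (Suc n) i)"
  proof -
    have "?t (Suc n) 0 = \<one>" by simp
    with finsum_Suc2[OF t, of "Suc n" n] show ?thesis by simp
  qed
  finally show ?case .
qed

lemma (in cring) add_pow_dvd_eq_zero:
  fixes p m :: nat
  assumes "[p] \<cdot> \<one> = \<zero>" "p dvd m" "x \<in> carrier R"
  shows "[m] \<cdot> x = \<zero>"
proof -
  obtain k where k: "m = k * p" using assms(2) by (metis dvdE mult.commute)
  have "[p] \<cdot> x = [p] \<cdot> \<one> \<otimes> x" using assms(3) by (simp add: add_pow_ldistr)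
  then have "[p] \<cdot> x = \<zero>" using assms by simp
  then show ?thesis using assms(3) k add.nat_pow_pow[of x k p] by (simp add: mult.commute)
qed

text \<open>The prime p divides all binomial coefficients except the two outer ones, and multiples
  of p annihilate the ring.\<close>

lemma (in cring) one_add_pow_prime:
  fixes p :: nat
  assumes p: "Factorial_Ring.prime p" and char: "[p] \<cdot> \<one> = \<zero>" and x: "x \<in> carrier R"
  shows "(\<one> \<oplus> x) [^] p = \<one> \<oplus> x [^] p"
proof -
  let ?t = "\<lambda>i. [(p choose i)] \<cdot> (x [^] (i::nat))"
  \<comment> \<open>With p = m + 2 the shifted range \<open>{..m}\<close> is exactly the inner
    indices 1 to p - 1.\<close>
  obtain m where m: "p = Suc (Suc m)"
    using prime_ge_2_nat[OF p] by (metis Suc_1 le_Suc_ex plus_1_eq_Suc add_Suc)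
  have zero: "?t i = \<zero>" if "0 < i" "i < p" for i
    using that p x by (intro add_pow_dvd_eq_zero[OF char] dvd_choose_prime) auto
  have t: "?t \<in> A \<rightarrow> carrier R" for A using x by auto
  have t': "(\<lambda>i. ?t (Suc i)) \<in> A \<rightarrow> carrier R" for A using x by auto
  have mid: "(\<Oplus>i\<in>{..m}. ?t (Suc i)) = \<zero>"
    using m by (intro add.finprod_one_eqI zero) auto
  have "(\<Oplus>i\<in>{..p}. ?t i) = ?t p \<oplus> (\<Oplus>i\<in>{..Suc m}. ?t i)"
    using finsum_Suc[OF t, of "Suc m"] by (simp only: m)
  also have "(\<Oplus>i\<in>{..Suc m}. ?t i) = (\<Oplus>i\<in>{..m}. ?t (Suc i)) \<oplus> ?t 0"
    by (rule finsum_Suc2[OF t])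
  also have "\<dots> = \<one>" unfolding mid by simp
  finally show ?thesis using x by (simp add: one_add_nat_pow a_comm[of "x [^] p" \<one>])
qed

context field begin

text \<open>For nonzero x, write x + y = x (1 + y / x) and apply the case of 1 + z.\<close>

lemma add_pow_prime:
  fixes p :: nat
  assumes p: "Factorial_Ring.prime p" and char: "[p] \<cdot> \<one> = \<zero>"
    and x: "x \<in> carrier R" and y: "y \<in> carrier R"
  shows "(x \<oplus> y) [^] p = x [^] p \<oplus> y [^] p"
proof (cases "x = \<zero>")
  case True
  then show ?thesis using y prime_gt_0_nat[OF p] by (simp add: nat_pow_zero)
next
  case False
  then have u: "x \<in> Units R" using x by (simp add: field_Units)
  define z where "z = inv x \<otimes> y"
  have z: "z \<in> carrier R" "x \<otimes> z = y" using u x y by (simp_all add: z_def m_assoc[symmetric])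
  have "(x \<oplus> y) [^] p = (x \<otimes> (\<one> \<oplus> z)) [^] p" using x z by (simp add: r_distr)
  also have "\<dots> = x [^] p \<otimes> (\<one> \<oplus> z [^] p)"
    using x z by (simp add: nat_pow_distrib one_add_pow_prime[OF p char])
  also have "\<dots> = x [^] p \<oplus> (x \<otimes> z) [^] p" using x z(1) by (simp add: r_distr nat_pow_distrib)
  finally show ?thesis using z by simp
qed

lemma add_pow_prime_power:
  fixes p a :: nat
  assumes p: "Factorial_Ring.prime p" and char: "[p] \<cdot> \<one> = \<zero>"
    and x: "x \<in> carrier R" and y: "y \<in> carrier R"
  shows "(x \<oplus> y) [^] (p ^ a) = x [^] (p ^ a) \<oplus> y [^] (p ^ a)"
proof (induction a)
  case 0
  then show ?case using x y by simp
next
  case (Suc a)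
  have pow: "z [^] (p ^ Suc a) = (z [^] (p ^ a)) [^] p" if "z \<in> carrier R" for z
    using that by (simp add: nat_pow_pow mult.commute)
  show ?case using Suc x y by (simp add: pow add_pow_prime[OF p char] del: power_Suc)
qed

text \<open>The order of the additive group annihilates 1, and p ^ r times 1 is the r-th power of p
  times 1. A field has no nonzero nilpotent elements.\<close>

lemma char_of_prime_power_order:
  assumes "order R = p ^ r" "finite (carrier R)"
  shows "[p] \<cdot> \<one> = \<zero>"
proof -
  have "[(p ^ r)] \<cdot> \<one> = \<zero>"
    using add.pow_order_eq_1[of \<one>] assms by (simp add: order_def)
  moreover have "[(p ^ r)] \<cdot> \<one> = ([p] \<cdot> \<one>) [^] r"
  proof (induction r)
    case (Suc r)
    have "[(p ^ Suc r)] \<cdot> \<one> = [(p ^ r)] \<cdot> ([p] \<cdot> \<one>)"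
      by (simp add: add.nat_pow_pow mult.commute)
    also have "\<dots> = ([(p ^ r)] \<cdot> \<one>) \<otimes> ([p] \<cdot> \<one>)" by (simp add: add_pow_ldistr)
    finally show ?case using Suc by simp
  qed simp
  moreover have "x = \<zero>" if "x [^] n = \<zero>" "x \<in> carrier R" for x and n :: nat
    using that by (induction n) (auto simp: integral_iff)
  ultimately show ?thesis by simp
qed

end


section \<open>Subfields and subgroups of the multiplicative group\<close>

context field begin

text \<open>These are the fixed points of the a-th iterate of the Frobenius map, which is additive
  and multiplicative.\<close>

lemma subfield_fixed_prime_power:
  fixes p a :: nat
  assumes p: "Factorial_Ring.prime p" and char: "[p] \<cdot> \<one> = \<zero>"
  shows "subfield {x \<in> carrier R. x [^] (p ^ a) = x} R"
proof (intro subfieldI' subringI)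
  have pos: "p ^ a > 0" using prime_gt_0_nat[OF p] by simp
  let ?K = "{x \<in> carrier R. x [^] (p ^ a) = x}"
  fix x assume x: "x \<in> ?K"
  \<comment> \<open>Additivity applied to -x + x = 0 handles negatives without distinguishing odd p
    from p = 2.\<close>
  have "(\<ominus> x \<oplus> x) [^] (p ^ a) = (\<ominus> x) [^] (p ^ a) \<oplus> x [^] (p ^ a)"
    using x by (intro add_pow_prime_power[OF p char]) auto
  then have "(\<ominus> x) [^] (p ^ a) \<oplus> x = \<zero>" using x pos by (simp add: l_neg nat_pow_zero)
  then have "\<ominus> x = (\<ominus> x) [^] (p ^ a)" using x by (intro minus_equality) auto
  then show "\<ominus> x \<in> ?K" using x by simp
  fix y assume y: "y \<in> ?K"
  show "x \<otimes> y \<in> ?K" using x y by (simp add: nat_pow_distrib)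
  show "x \<oplus> y \<in> ?K" using x y by (simp add: add_pow_prime_power[OF p char])
next
  fix x assume x: "x \<in> {x \<in> carrier R. x [^] (p ^ a) = x} - {\<zero>}"
  then have u: "x \<in> Units R" by (simp add: field_Units)
  have "(inv x) [^] (p ^ a) \<otimes> x [^] (p ^ a) = (inv x \<otimes> x) [^] (p ^ a)"
    using u by (intro nat_pow_distrib[symmetric]) (simp_all add: Units_closed)
  then have "x \<otimes> (inv x) [^] (p ^ a) = \<one>"
    using x u by (simp add: m_comm)
  then have "inv x = (inv x) [^] (p ^ a)"
    using u by (intro comm_inv_char) (simp_all add: Units_closed)
  then show "inv x \<in> {x \<in> carrier R. x [^] (p ^ a) = x}" using u by simp
qed auto

text \<open>By Lagrange H consists of roots of X ^ n - 1, of which there are at most n. This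
  determines H by its order and so justifies the definite description in
  \<open>gpaley\<close>.\<close>

lemma subgroup_mult_of_eq_roots:
  assumes fin: "finite (carrier R)" and H: "subgroup H (mult_of R)" and card: "card H = n"
  shows "H = {x \<in> carrier R. x [^] n = \<one>}"
proof (rule card_seteq)
  interpret M: group "mult_of R" by (rule field_mult_group)
  have sub: "H \<subseteq> carrier R" using subgroup.subset[OF H] by auto
  then have finH: "finite H" using fin finite_subset by blast
  then have n: "n \<noteq> 0" using subgroup.one_closed[OF H] card card_gt_0_iff by blast
  show "finite {x \<in> carrier R. x [^] n = \<one>}" using fin by simp
  show "card {x \<in> carrier R. x [^] n = \<one>} \<le> card H"
    using num_roots_le_deg[OF fin n] card by simp
  show "H \<subseteq> {x \<in> carrier R. x [^] n = \<one>}"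
  proof
    fix x assume x: "x \<in> H"
    interpret H: group "mult_of R\<lparr>carrier := H\<rparr>"
      using H by (rule M.subgroup_imp_group)
    have "x [^]\<^bsub>mult_of R\<lparr>carrier := H\<rparr>\<^esub> order (mult_of R\<lparr>carrier := H\<rparr>) = \<one>"
      using H.pow_order_eq_1[of x] x by simp
    then have "x [^] n = \<one>"
      using card by (simp add: M.nat_pow_consistent[symmetric] nat_pow_mult_of order_def)
    then show "x \<in> {x \<in> carrier R. x [^] n = \<one>}" using x sub by auto
  qed
qed

lemma gpaley_eq_cay_graph:
  assumes "finite (carrier R)" "subgroup H (mult_of R)" "card H = n"
  shows "gpaley R n = cay_graph R H"
proof -
  have "(THE S. subgroup S (mult_of R) \<and> card S = n) = H"
  proof (rule the_equality)
    show "subgroup H (mult_of R) \<and> card H = n" using assms by simp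
    show "S = H" if "subgroup S (mult_of R) \<and> card S = n" for S
      using that assms subgroup_mult_of_eq_roots by metis
  qed
  then show ?thesis by (simp add: gpaley_def)
qed

lemma generate_primitive_pow:
  assumes fin: "finite (carrier R)" and \<omega>: "\<omega> \<in> carrier (mult_of R)"
    and gen: "generate (mult_of R) {\<omega>} = carrier (mult_of R)"
    and d: "d dvd order R - 1" "d \<noteq> 0"
  shows "subgroup (generate (mult_of R) {\<omega> [^] d}) (mult_of R)"
    and "card (generate (mult_of R) {\<omega> [^] d}) = (order R - 1) div d"
proof -
  interpret M: group "mult_of R" by (rule field_mult_group)
  have \<omega>d: "\<omega> [^] d \<in> carrier (mult_of R)"
    using M.nat_pow_closed[OF \<omega>, of d] by (simp only: nat_pow_mult_of)
  then show "subgroup (generate (mult_of R) {\<omega> [^] d}) (mult_of R)"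
    by (intro M.generate_is_subgroup) simp
  have "M.ord \<omega> = order R - 1"
    using M.generate_pow_card[OF \<omega>] gen order_mult_of[OF fin] by (simp add: order_def)
  then have "M.ord (\<omega> [^] d) = (order R - 1) div d"
    using M.ord_pow[OF \<omega>, of d] d by (simp add: nat_pow_mult_of)
  then show "card (generate (mult_of R) {\<omega> [^] d}) = (order R - 1) div d"
    using M.generate_pow_card[OF \<omega>d] by simp
qed

text \<open>Multiplication by a nonzero k is injective on the finite set W, hence onto W, and
  therefore hits 1.\<close>

lemma subfieldI_finite:
  assumes fin: "finite (carrier R)" and W: "subring W R"
  shows "subfield W R"
proof (rule subfieldI'[OF W])
  fix k assume k: "k \<in> W - {\<zero>}"
  have sub: "W \<subseteq> carrier R" using W by (rule subringE)
  have u: "k \<in> Units R" using k sub by (auto simp: field_Units)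
  have "inj_on (\<lambda>x. k \<otimes> x) W"
    using sub u by (intro inj_onI) (metis Units_l_cancel subsetD)
  moreover have "(\<lambda>x. k \<otimes> x) ` W \<subseteq> W" using k subringE(6)[OF W] by auto
  ultimately have "(\<lambda>x. k \<otimes> x) ` W = W"
    using fin sub by (meson endo_inj_surj finite_subset)
  then obtain x where "x \<in> W" "k \<otimes> x = \<one>" using subringE(3)[OF W] by (metis imageE)
  then show "inv k \<in> W" using k sub by (metis DiffD1 comm_inv_char subsetD)
qed

text \<open>Multiplication by \<open>a\<close> is additive, so it suffices to test generators.
  Below, A is the span itself, an invariant subspace, or the span of a scaled set.\<close>

lemma additive_span_mult_closed:
  assumes T: "T \<subseteq> carrier R" and A: "subgroup A (add_monoid R)"
    and a: "a \<in> carrier R" "\<And>t. t \<in> T \<Longrightarrow> t \<otimes> a \<in> A"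
    and x: "x \<in> generate (add_monoid R) T"
  shows "x \<otimes> a \<in> A"
proof -
  have minus: "\<ominus> y \<in> A" if "y \<in> A" for y
    using subgroup.m_inv_closed[OF A that] by (simp add: a_inv_def)
  show ?thesis using x
  proof (induction rule: generate.induct)
    case one
    then show ?case using a(1) subgroup.one_closed[OF A] by simp
  next
    case (incl h)
    then show ?case by (rule a(2))
  next
    case (inv h)
    then have "h \<in> carrier R" "h \<otimes> a \<in> A" using T a(2) by auto
    then have "\<ominus> (h \<otimes> a) \<in> A" "\<ominus> (h \<otimes> a) = \<ominus> h \<otimes> a"
      using minus a(1) by (auto simp: l_minus)
    then show ?case by (simp add: a_inv_def)
  next
    case (eng h1 h2)
    have "generate (add_monoid R) T \<subseteq> carrier R"
      using add.generate_incl T by simp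
    then have "h1 \<in> carrier R" "h2 \<in> carrier R" using eng.hyps by auto
    then show ?case
      using eng.IH subgroup.m_closed[OF A] a(1) by (simp add: l_distr)
  qed
qed

text \<open>Closure under products takes two passes over the generators: first W t lies in W for t
  in T, because T is closed; then W w lies in W for w in W, because T w does.\<close>

lemma subfield_additive_span:
  assumes fin: "finite (carrier R)" and T: "subgroup T (mult_of R)"
  shows "subfield (generate (add_monoid R) T) R"
proof (rule subfieldI_finite[OF fin])
  let ?W = "generate (add_monoid R) T"
  have Tc: "T \<subseteq> carrier R" using subgroup.subset[OF T] by auto
  have W: "subgroup ?W (add_monoid R)" using Tc by (intro add.generate_is_subgroup) simp
  have Wc: "?W \<subseteq> carrier R" using subgroup.subset[OF W] by simp
  have TW: "t \<otimes> w \<in> ?W" if t: "t \<in> T" and w: "w \<in> ?W" for t w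
  proof -
    have "w \<otimes> t \<in> ?W"
    proof (rule additive_span_mult_closed[OF Tc W _ _ w])
      show "t \<in> carrier R" using t Tc by blast
      show "s \<otimes> t \<in> ?W" if "s \<in> T" for s
        using subgroup.m_closed[OF T that t] by (simp add: generate.incl)
    qed
    then show ?thesis using t w Tc Wc by (metis m_comm subsetD)
  qed
  show "subring ?W R"
  proof (rule subringI)
    show "?W \<subseteq> carrier R" by (rule Wc)
    show "\<one> \<in> ?W" using subgroup.one_closed[OF T] by (auto intro: generate.incl)
    show "\<ominus> h \<in> ?W" if "h \<in> ?W" for h
      using subgroup.m_inv_closed[OF W that] by (simp add: a_inv_def)
    show "h1 \<oplus> h2 \<in> ?W" if "h1 \<in> ?W" "h2 \<in> ?W" for h1 h2
      using subgroup.m_closed[OF W that] by simp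
    show "h1 \<otimes> h2 \<in> ?W" if "h1 \<in> ?W" "h2 \<in> ?W" for h1 h2
      using additive_span_mult_closed[OF Tc W _ TW that(1)] that Wc by blast
  qed
qed

end

text \<open>A Euclidean descent on exponents: with s = r - a, the number p ^ r - 1 equals p ^ s (p ^
  a - 1) + (p ^ s - 1). Once r < a, divisibility forces p ^ r - 1 = 0, so r = 0.\<close>

lemma dvd_of_power_minus_one_dvd:
  fixes p a r :: nat
  assumes p: "2 \<le> p" and a: "1 \<le> a" and dvd: "p ^ a - 1 dvd p ^ r - 1"
  shows "a dvd r"
  using dvd
proof (induction r rule: less_induct)
  case (less r)
  show ?case
  proof (cases "r < a")
    case True
    have "p ^ r - 1 < p ^ a - 1"
      using True p by (intro diff_less_mono) auto
    with less.prems have "p ^ r - 1 = 0" by (auto dest: nat_dvd_not_less)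
    then have "p ^ r \<le> 1" by simp
    then have "r = 0" using p one_less_power[of p r] by (cases "r = 0") auto
    then show ?thesis by simp
  next
    case False
    define s where "s = r - a"
    have r: "r = s + a" using False by (simp add: s_def)
    have pos: "1 \<le> p ^ s" "1 \<le> p ^ a" using p by auto
    have "p ^ r - 1 = p ^ s * (p ^ a - 1) + (p ^ s - 1)"
      using pos by (simp add: r power_add algebra_simps)
    then have "p ^ a - 1 dvd p ^ s - 1"
      using less.prems by (metis dvd_add_right_iff dvd_triv_right)
    then have "a dvd s" using less.IH[of s] a r by simp
    then show ?thesis by (simp add: r)
  qed
qed

text \<open>Lagrange is applied twice in place of a dimension argument: additively it makes |K| a
  power p ^ a, and multiplicatively it makes p ^ a - 1 divide p ^ r - 1, which forces a to divide
  r.\<close>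

lemma (in field) card_subfield:
  fixes p r :: nat
  assumes p: "Factorial_Ring.prime p" and ord: "order R = p ^ r" and fin: "finite (carrier R)"
    and K: "subfield K R"
  obtains a where "1 \<le> a" "a dvd r" "card K = p ^ a"
proof -
  have Kc: "K \<subseteq> carrier R" using K by (rule subfieldE)
  have finK: "finite K" using Kc fin by (rule finite_subset)
  have "subgroup K (add_monoid R)" using K by (intro subring.axioms(1) subfieldE(1))
  then have "card K dvd p ^ r"
    using add.lagrange ord by (metis dvd_triv_right order_def partial_object.simps(1) monoid.simps(1))
  then obtain a where a: "card K = p ^ a" using divides_primepow_nat[OF p] by blast
  have z: "\<zero> \<in> K" "\<one> \<in> K" using K subringE(2,3) subfieldE(1) by blast+
  have "card {\<zero>, \<one>} \<le> card K" using z finK by (intro card_mono) auto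
  then have a1: "1 \<le> a" using a by (cases a) auto
  interpret M: group "mult_of R" by (rule field_mult_group)
  have "card (K - {\<zero>}) dvd order (mult_of R)"
    using M.lagrange[OF subgroup_mult_of[OF K]] by (metis dvd_triv_right)
  then have "p ^ a - 1 dvd p ^ r - 1"
    using z a finK ord order_mult_of[OF fin] by (simp add: card_Diff_singleton)
  then have "a dvd r" using dvd_of_power_minus_one_dvd[of p a r] a1 prime_ge_2_nat[OF p] by blast
  then show thesis by (rule that[OF a1 _ a])
qed


section \<open>Spans of subgroups of the multiplicative group\<close>

context field begin

lemma mult_map_Bij:
  assumes s: "s \<in> carrier (mult_of R)"
  shows "mult_map R s \<in> Bij (carrier R)"
proof -
  have u: "s \<in> Units R" using s by (simp add: field_Units)
  have "bij_betw (mult_map R s) (carrier R) (carrier R)"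
  proof (rule bij_betwI[where g = "\<lambda>x. x \<otimes> inv s"])
    show "mult_map R s \<in> carrier R \<rightarrow> carrier R" using s by (auto simp: mult_map_def)
    show "(\<lambda>x. x \<otimes> inv s) \<in> carrier R \<rightarrow> carrier R" using u by auto
  qed (use s u in \<open>auto simp: mult_map_def m_assoc\<close>)
  then show ?thesis by (simp add: Bij_def mult_map_def)
qed

text \<open>A homomorphism carries generated subgroups to generated subgroups, so the permutation
  group generated by the k-th power of \<open>mult_map R \<omega>\<close> is the image of S.\<close>

lemma mult_map_hom: "group_hom (mult_of R) (BijGroup (carrier R)) (mult_map R)"
proof (intro group_hom.intro field_mult_group group_BijGroup group_hom_axioms.intro homI)
  fix s assume s: "s \<in> carrier (mult_of R)"
  then show "mult_map R s \<in> carrier (BijGroup (carrier R))"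
    by (simp only: BijGroup_def partial_object.simps mult_map_Bij)
  fix t assume t: "t \<in> carrier (mult_of R)"
  have "mult_map R (s \<otimes> t) = compose (carrier R) (mult_map R s) (mult_map R t)"
    using s t by (auto simp: mult_map_def compose_def m_ac intro!: restrict_ext)
  then show "mult_map R (s \<otimes>\<^bsub>mult_of R\<^esub> t) =
      mult_map R s \<otimes>\<^bsub>BijGroup (carrier R)\<^esub> mult_map R t"
    using mult_map_Bij[OF s] mult_map_Bij[OF t] by (simp add: BijGroup_def)
qed

text \<open>The span is itself an invariant subspace: as a subfield it contains the prime field and
  is closed under products with S. It contains 1, so irreducibility leaves only the whole
  field.\<close>

lemma acts_irreducibly_iff:
  assumes fin: "finite (carrier R)" and S: "subgroup S (mult_of R)"
  shows "acts_irreducibly R (mult_map R ` S) \<longleftrightarrow> generate (add_monoid R) S = carrier R"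
proof
  let ?W = "generate (add_monoid R) S" and ?P = "generate_field R {}"
  have Sc: "S \<subseteq> carrier R" using subgroup.subset[OF S] by auto
  {
    assume irr: "acts_irreducibly R (mult_map R ` S)"
    have K: "subfield ?W R" using fin S by (rule subfield_additive_span)
    have W: "subgroup ?W (add_monoid R)" using Sc by (intro add.generate_is_subgroup) simp
    have Wc: "?W \<subseteq> carrier R" using K by (rule subfieldE)
    have Wm: "x \<otimes> y \<in> ?W" if "x \<in> ?W" "y \<in> ?W" for x y
      using subringE(6)[OF subfieldE(1)[OF K] that] .
    have "?P \<subseteq> ?W" using K by (intro generate_field_min_subfield1) auto
    then have "subalgebra ?P ?W R"
      using W Wm by (auto simp: subalgebra_def subalgebra_axioms_def)
    moreover have "h ` ?W \<subseteq> ?W" if "h \<in> mult_map R ` S" for h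
    proof -
      obtain s where s: "s \<in> S" "h = mult_map R s" using \<open>h \<in> mult_map R ` S\<close> by blast
      have "s \<in> ?W" using s(1) by (rule generate.incl)
      then show ?thesis using Wc Wm s(2) by (auto simp: mult_map_def)
    qed
    ultimately have "?W = {\<zero>} \<or> ?W = carrier R"
      using irr unfolding acts_irreducibly_def by blast
    moreover have "\<one> \<in> ?W" using subringE(3)[OF subfieldE(1)[OF K]] .
    ultimately show "?W = carrier R" using one_not_zero by (metis singletonD)
  }
  assume gen: "?W = carrier R"
  show "acts_irreducibly R (mult_map R ` S)"
    unfolding acts_irreducibly_def
  proof (intro conjI allI impI)
    show "carrier R \<noteq> {\<zero>}" using one_closed one_not_zero by blast
    fix U assume U: "subalgebra ?P U R \<and> (\<forall>h\<in>mult_map R ` S. h ` U \<subseteq> U)"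
    then have sg: "subgroup U (add_monoid R)" by (simp add: subalgebra_def)
    have Uc: "U \<subseteq> carrier R" using subgroup.subset[OF sg] by simp
    have z: "\<zero> \<in> U" using subgroup.one_closed[OF sg] by simp
    have SU: "s \<otimes> u \<in> U" if "s \<in> S" "u \<in> U" for s u
    proof -
      have "mult_map R s u \<in> U" using U that by blast
      then show ?thesis using that Uc Sc by (simp add: mult_map_def m_comm subset_eq)
    qed
    show "U = {\<zero>} \<or> U = carrier R"
    proof (cases "U = {\<zero>}")
      case False
      then obtain w where w: "w \<in> U" "w \<noteq> \<zero>" using z by blast
      then have wU: "w \<in> Units R" using Uc by (auto simp: field_Units)
      have "x \<in> U" if x: "x \<in> carrier R" for x
      proof -
        have xw: "x \<otimes> inv w \<in> ?W" using gen x wU by simp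
        have "x \<otimes> inv w \<otimes> w \<in> U"
          by (rule additive_span_mult_closed[OF Sc sg _ _ xw]) (use w Uc SU in auto)
        moreover have "x \<otimes> inv w \<otimes> w = x" using x wU by (simp add: m_assoc Units_closed)
        ultimately show "x \<in> U" by simp
      qed
      then show ?thesis using Uc by blast
    qed simp
  qed
qed

text \<open>Transfers spanning between S and the connection sets S \<omega> ^ i of the cyclotomic
  classes, in both directions, by scaling with \<omega> ^ i or its inverse.\<close>

lemma additive_span_mult_right:
  assumes T: "T \<subseteq> carrier R" and c: "c \<in> Units R"
    and gen: "generate (add_monoid R) T = carrier R"
  shows "generate (add_monoid R) ((\<lambda>t. t \<otimes> c) ` T) = carrier R"
proof
  let ?U = "generate (add_monoid R) ((\<lambda>t. t \<otimes> c) ` T)"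
  have sub: "(\<lambda>t. t \<otimes> c) ` T \<subseteq> carrier R" using T c by auto
  then have U: "subgroup ?U (add_monoid R)" by (intro add.generate_is_subgroup) simp
  show "?U \<subseteq> carrier R" using subgroup.subset[OF U] by simp
  show "carrier R \<subseteq> ?U"
  proof
    fix x assume x: "x \<in> carrier R"
    then have xc: "x \<otimes> inv c \<in> generate (add_monoid R) T" using c gen by simp
    have "x \<otimes> inv c \<otimes> c \<in> ?U"
      by (rule additive_span_mult_closed[OF T U _ _ xc]) (use c in \<open>auto intro: generate.incl\<close>)
    moreover have "x \<otimes> inv c \<otimes> c = x" using x c by (simp add: m_assoc Units_closed)
    ultimately show "x \<in> ?U" by simp
  qed
qed

lemma minus_subfield:
  assumes K: "subfield K R" and "x \<in> K" "y \<in> K"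
  shows "x \<ominus>\<^bsub>R\<lparr>carrier := K\<rparr>\<^esub> y = x \<ominus> y"
proof -
  have sg: "subgroup K (add_monoid R)" using K by (intro subring.axioms(1) subfieldE(1))
  have "a_inv (R\<lparr>carrier := K\<rparr>) y = \<ominus> y"
    using add.m_inv_consistent[OF sg assms(3)] by (simp add: a_inv_def)
  then show ?thesis by (simp add: a_minus_def)
qed

lemma cay_graph_subfield:
  assumes K: "subfield K R"
  shows "cay_graph (R\<lparr>carrier := K\<rparr>) T = cay_graph R T \<restriction> K"
proof -
  have "K \<subseteq> carrier R" using K by (rule subfieldE)
  then show ?thesis
    using minus_subfield[OF K]
    by (intro pre_digraph.equality) (auto simp: cay_graph_def)
qed

lemma subgroup_mult_of_subfield:
  assumes K: "subfield K R" and H: "subgroup H (mult_of R)" and sub: "H \<subseteq> K"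
  shows "subgroup H (mult_of (R\<lparr>carrier := K\<rparr>))"
proof -
  interpret M: group "mult_of R" by (rule field_mult_group)
  have "H \<subseteq> K - {\<zero>}" using sub subgroup.subset[OF H] by auto
  then have "subgroup H (mult_of R\<lparr>carrier := K - {\<zero>}\<rparr>)"
    using H subgroup_mult_of[OF K] by (intro M.subgroup_incl)
  then show ?thesis by (simp add: mult_of_def)
qed

end

text \<open>Both sides say that N divides m k; this is symmetric in m and k, so one implication
  suffices.\<close>

lemma div_dvd_swap:
  fixes N m k :: nat
  assumes "m dvd N" "k dvd N" "N > 0"
  shows "N div m dvd k \<longleftrightarrow> N div k dvd m"
proof -
  have imp: "N div k dvd m" if d: "m dvd N" "k dvd N" "N div m dvd k" for m k
  proof -
    obtain c where c: "k = (N div m) * c" using d(3) by blast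
    have "(N div m) * c * (N div k) = (N div m) * m"
      using d c by (metis dvd_div_mult_self dvd_mult_div_cancel)
    moreover have "N div m > 0" using assms(3) d(1) by (auto elim!: dvdE)
    ultimately have "m = c * (N div k)" by (simp add: mult.assoc)
    then show ?thesis by simp
  qed
  then show ?thesis using assms by blast
qed

lemma minus_one_dvd_power_minus_one:
  fixes x :: nat
  assumes "0 < x"
  shows "x - 1 dvd x ^ c - 1"
proof (induction c)
  case (Suc c)
  have "x ^ Suc c - 1 = x * (x ^ c - 1) + (x - 1)"
    using assms by (simp add: diff_mult_distrib2)
  then show ?case using Suc by (metis dvd_add dvd_mult dvd_refl)
qed simp

section \<open>Generalised Paley graphs over a fixed finite field\<close>

locale gpaley_setting = field F for F :: "'a ring" (structure) +
  fixes \<omega> :: 'a and p r k :: nat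
  assumes p: "Factorial_Ring.prime p" and r: "1 \<le> r" and order_F: "order F = p ^ r"
    and k_dvd: "k dvd order F - 1" and k_ge: "2 \<le> k"
    and parity: "even (order F) \<or> even ((order F - 1) div k)"
    and \<omega>: "\<omega> \<in> carrier (mult_of F)" "generate (mult_of F) {\<omega>} = carrier (mult_of F)"
begin

definition S :: "'a set" where "S = generate (mult_of F) {\<omega> [^] k}"
definition n :: nat where "n = (order F - 1) div k"
definition W :: "'a set" where "W = generate (add_monoid F) S"

lemma fin: "finite (carrier F)"
proof -
  have "order F > 0" using order_F prime_gt_0_nat[OF p] by simp
  then show ?thesis using add.order_gt_0_iff_finite by (simp add: order_def)
qed

lemma order_pos: "order F - 1 > 0"
proof -
  have "1 < p ^ r" using prime_gt_1_nat[OF p] r by (intro one_less_power) auto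
  then show ?thesis by (simp add: order_F)
qed

lemma n_mult: "n * k = order F - 1" "n dvd order F - 1" "n > 0"
proof -
  show nk: "n * k = order F - 1" using k_dvd by (simp add: n_def)
  then show "n dvd order F - 1" by (metis dvd_triv_left)
  show "n > 0" using nk order_pos by (cases n) auto
qed

lemma subgroup_S: "subgroup S (mult_of F)" and card_S: "card S = n"
  using generate_primitive_pow[OF fin \<omega> k_dvd] k_ge by (simp_all add: S_def n_def)

lemma S_eq: "S = {x \<in> carrier F. x [^] n = \<one>}"
  by (rule subgroup_mult_of_eq_roots[OF fin subgroup_S card_S])

lemma S_carrier: "S \<subseteq> carrier F" and zero_notin_S: "\<zero> \<notin> S"
  using subgroup.subset[OF subgroup_S] by auto

lemma char: "[p] \<cdot> \<one> = \<zero>"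
  using order_F fin by (rule char_of_prime_power_order)

text \<open>The only place where the parity condition enters. If n = |S| is even, then -1 is an n-th
  root of unity; otherwise q is even, so p = 2 and -1 = 1.\<close>

lemma minus_one_in_S: "\<ominus> \<one> \<in> S"
proof (cases "even n")
  case True
  then obtain m where m: "n = 2 * m" by blast
  have "(\<ominus> \<one>) [^] (2::nat) = \<one>" by (simp add: numeral_2_eq_2 l_minus r_minus)
  then have "(\<ominus> \<one>) [^] n = \<one>" by (simp add: m nat_pow_pow[symmetric])
  then show ?thesis by (simp add: S_eq)
next
  case False
  then have "even (p ^ r)" using parity order_F by (simp add: n_def)
  then have "even p" by simp
  then have "p = 2" using p primes_dvd_imp_eq two_is_prime_nat by blast
  then have "\<one> \<oplus> \<one> = \<zero>" using char by (simp add: numeral_2_eq_2)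
  then have "\<ominus> \<one> = \<one>" by (intro minus_equality) auto
  then show ?thesis using subgroup.one_closed[OF subgroup_S] by simp
qed

lemma S_uminus: "t \<in> S \<Longrightarrow> \<ominus> t \<in> S"
proof -
  assume t: "t \<in> S"
  then have "\<ominus> \<one> \<otimes> t \<in> S" using subgroup.m_closed[OF subgroup_S minus_one_in_S] by simp
  then show ?thesis using t S_carrier by (auto simp: l_minus)
qed

lemma gpaley_eq: "gpaley F n = cay_graph F S"
  by (rule gpaley_eq_cay_graph[OF fin subgroup_S card_S])

lemma graph_\<Gamma>: "graph (cay_graph F S)"
  using fin zero_notin_S S_uminus by (rule graph_cay_graph)

section \<open>Connectedness, primitivity and irreducibility in terms of the span
  \<open>W\<close>\<close>

lemma connected_iff: "Digraph_Component.connected (cay_graph F S) \<longleftrightarrow> W = carrier F"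
  unfolding W_def using S_carrier S_uminus by (rule connected_cay_graph_iff)

text \<open>Since S = -S, the set S \<omega> ^ i is closed under negation. Hence neither the
  converse in \<open>relation_graph\<close> nor the use of y - x in place of x - y makes a
  difference.\<close>

lemma relation_graph_eq:
  assumes "1 \<le> i"
  shows "relation_graph (cyc F \<omega> k) i = cay_graph F ((\<lambda>s. s \<otimes> \<omega> [^] i) ` S)"
    and "t \<in> (\<lambda>s. s \<otimes> \<omega> [^] i) ` S \<Longrightarrow> \<ominus> t \<in> (\<lambda>s. s \<otimes> \<omega> [^] i) ` S"
proof -
  let ?T = "(\<lambda>s. s \<otimes> \<omega> [^] i) ` S"
  have \<omega>c: "\<omega> \<in> carrier F" using \<omega> by simp
  show neg: "\<ominus> t \<in> ?T" if "t \<in> ?T" for t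
  proof -
    obtain s where s: "s \<in> S" "t = s \<otimes> \<omega> [^] i" using \<open>t \<in> ?T\<close> by blast
    then have "\<ominus> t = \<ominus> s \<otimes> \<omega> [^] i" using S_carrier \<omega>c by (auto simp: l_minus)
    then show ?thesis using S_uminus s(1) by blast
  qed
  have swap: "y \<ominus> x \<in> ?T \<longleftrightarrow> x \<ominus> y \<in> ?T" if "x \<in> carrier F" "y \<in> carrier F" for x y
    using neg[of "y \<ominus> x"] neg[of "x \<ominus> y"] that by (auto simp: minus_diff_eq)
  have coset: "generate (mult_of F) {\<omega> [^] k} #>\<^bsub>mult_of F\<^esub> (\<omega> [^] i) = ?T"
    by (auto simp: r_coset_def S_def)
  show "relation_graph (cyc F \<omega> k) i = cay_graph F ?T"
    using assms swap
    by (auto simp: relation_graph_def cyc_def cay_graph_def coset intro!: arg_cong[of _ _ with_proj])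
qed

lemma primitive_iff: "primitive_scheme (cyc F \<omega> k) \<longleftrightarrow> W = carrier F"
proof -
  have \<omega>U: "\<omega> [^] i \<in> Units F" for i :: nat
    using \<omega>(1) by (intro Units_pow_closed) (simp add: field_Units)
  let ?T = "\<lambda>i::nat. (\<lambda>s. s \<otimes> \<omega> [^] i) ` S"
  have Tc: "?T i \<subseteq> carrier F" for i using S_carrier \<omega>U[of i] by auto
  have conn: "Digraph_Component.connected (relation_graph (cyc F \<omega> k) i) \<longleftrightarrow>
      generate (add_monoid F) (?T i) = carrier F" if "1 \<le> i" for i
    using that Tc relation_graph_eq(2)[OF that]
    by (simp add: relation_graph_eq(1) connected_cay_graph_iff)
  have gen: "generate (add_monoid F) (?T i) = carrier F \<longleftrightarrow> W = carrier F" for i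
  proof
    assume "generate (add_monoid F) (?T i) = carrier F"
    then have "generate (add_monoid F) ((\<lambda>t. t \<otimes> inv (\<omega> [^] i)) ` ?T i) = carrier F"
      by (rule additive_span_mult_right[OF Tc Units_inv_Units[OF \<omega>U]])
    moreover have "(\<lambda>t. t \<otimes> inv (\<omega> [^] i)) ` ?T i = S"
    proof -
      have "s \<otimes> \<omega> [^] i \<otimes> inv (\<omega> [^] i) = s" if "s \<in> S" for s
        using that S_carrier \<omega>U[of i] by (simp add: m_assoc Units_closed subset_eq)
      then show ?thesis by (simp add: image_image)
    qed
    ultimately show "W = carrier F" by (simp add: W_def)
  next
    assume "W = carrier F"
    then show "generate (add_monoid F) (?T i) = carrier F"
      using additive_span_mult_right[OF S_carrier \<omega>U] by (simp add: W_def)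
  qed
  have "scheme_classes (cyc F \<omega> k) = k" by (simp add: cyc_def)
  \<comment> \<open>As k is positive there is at least one class, so primitivity does force W =
    F.\<close>
  then show ?thesis
    using conn gen k_ge by (auto simp: primitive_scheme_def)
qed

lemma irreducible_iff:
  "acts_irreducibly F (generate (BijGroup (carrier F))
     {mult_map F \<omega> [^]\<^bsub>BijGroup (carrier F)\<^esub> k}) \<longleftrightarrow> W = carrier F"
proof -
  interpret h: group_hom "mult_of F" "BijGroup (carrier F)" "mult_map F" by (rule mult_map_hom)
  have \<omega>k: "\<omega> [^] k \<in> carrier (mult_of F)"
    using h.G.nat_pow_closed[OF \<omega>(1), of k] by (simp only: nat_pow_mult_of)
  have "mult_map F \<omega> [^]\<^bsub>BijGroup (carrier F)\<^esub> k = mult_map F (\<omega> [^] k)"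
    using h.hom_nat_pow[OF \<omega>(1), of k] by (simp add: nat_pow_mult_of)
  moreover have "generate (BijGroup (carrier F)) {mult_map F (\<omega> [^] k)} = mult_map F ` S"
    using h.generate_img[of "{\<omega> [^] k}"] \<omega>k by (simp add: S_def)
  ultimately show ?thesis
    using acts_irreducibly_iff[OF fin subgroup_S] by (simp add: W_def)
qed

section \<open>The order of \<open>W\<close> and the divisibility condition on
  \<open>k\<close>\<close>

lemma subfield_W: "subfield W F"
  unfolding W_def using fin subgroup_S by (rule subfield_additive_span)

lemma W_carrier: "W \<subseteq> carrier F"
  using subfield_W by (rule subfieldE)

lemma S_subset_W: "S \<subseteq> W"
  by (auto simp: W_def intro: generate.incl)

lemma subgroup_W: "subgroup W (add_monoid F)"
  using subfield_W by (intro subring.axioms(1) subfieldE(1))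

lemma power_dvd:
  assumes "1 \<le> a" "a dvd r"
  shows "p ^ a - 1 dvd order F - 1" "0 < p ^ a - 1"
proof -
  obtain c where c: "r = a * c" using assms(2) by blast
  show "p ^ a - 1 dvd order F - 1"
    using minus_one_dvd_power_minus_one[of "p ^ a" c] prime_gt_0_nat[OF p]
    by (simp add: order_F c power_mult)
  have "1 < p ^ a" using prime_gt_1_nat[OF p] assms(1) by (intro one_less_power) auto
  then show "0 < p ^ a - 1" by simp
qed

text \<open>The usable form of admissibility: |S| = n divides the order of the multiplicative group
  of a field with p ^ a elements.\<close>

lemma dvd_k_iff:
  assumes "1 \<le> a" "a dvd r"
  shows "(order F - 1) div (p ^ a - 1) dvd k \<longleftrightarrow> n dvd p ^ a - 1"
  unfolding n_def using power_dvd[OF assms] k_dvd order_pos by (intro div_dvd_swap)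

text \<open>S is a subgroup of the multiplicative group of the field W, so Lagrange applies once
  more. Thus W supplies an admissible exponent c of its own, unless c = r.\<close>

lemma obtain_card_W:
  obtains c where "1 \<le> c" "c dvd r" "card W = p ^ c" "n dvd p ^ c - 1"
proof -
  obtain c where c: "1 \<le> c" "c dvd r" "card W = p ^ c"
    using card_subfield[OF p order_F fin subfield_W] by blast
  interpret K: field "F\<lparr>carrier := W\<rparr>" using subfield_W by (rule subfield_iff(2))
  interpret M: group "mult_of (F\<lparr>carrier := W\<rparr>)" by (rule K.field_mult_group)
  have "card S dvd order (mult_of (F\<lparr>carrier := W\<rparr>))"
    using M.lagrange[OF subgroup_mult_of_subfield[OF subfield_W subgroup_S S_subset_W]]
    by (metis dvd_triv_right)
  then have "n dvd p ^ c - 1"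
    using K.order_mult_of finite_subset[OF W_carrier fin] c(3) card_S by (simp add: order_def)
  with c show thesis by (rule that)
qed

text \<open>Fixed points of x |-> x ^ (p ^ a) are zero and the roots of X ^ (p ^ a - 1) - 1. These
  roots form the subgroup of order p ^ a - 1, which fixes the size of K, and they include S because
  n divides p ^ a - 1.\<close>

lemma subfield_of_divisor:
  assumes a: "1 \<le> a" "a dvd r" and n: "n dvd p ^ a - 1"
  obtains K where "subfield K F" "card K = p ^ a" "W \<subseteq> K"
proof
  let ?K = "{x \<in> carrier F. x [^] (p ^ a) = x}"
  \<comment> \<open>The exponent for which \<omega> ^ d has order p ^ a - 1.\<close>
  let ?d = "(order F - 1) div (p ^ a - 1)"
  have pa: "p ^ a = Suc (p ^ a - 1)" using power_dvd(2)[OF a] by simp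
  show K: "subfield ?K F" by (rule subfield_fixed_prime_power[OF p char])
  have K_eq: "?K = insert \<zero> {x \<in> carrier F. x [^] (p ^ a - 1) = \<one>}"
  proof (intro equalityI subsetI)
    fix x assume x: "x \<in> ?K"
    then have "x [^] Suc (p ^ a - 1) = x" unfolding pa[symmetric] by simp
    then have "x [^] (p ^ a - 1) \<otimes> x = \<one> \<otimes> x" using x by simp
    then have "x = \<zero> \<or> x [^] (p ^ a - 1) = \<one>"
      using x m_rcancel[of x "x [^] (p ^ a - 1)" \<one>] by auto
    then show "x \<in> insert \<zero> {x \<in> carrier F. x [^] (p ^ a - 1) = \<one>}" using x by auto
  next
    fix x assume x: "x \<in> insert \<zero> {x \<in> carrier F. x [^] (p ^ a - 1) = \<one>}"
    show "x \<in> ?K"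
    proof (cases "x = \<zero>")
      case True
      then show ?thesis using prime_gt_0_nat[OF p] by (simp add: nat_pow_zero)
    next
      case False
      have "x [^] (p ^ a) = x" by (subst pa) (use x False in auto)
      then show ?thesis using x False by simp
    qed
  qed
  have d: "?d dvd order F - 1" "?d \<noteq> 0" "(order F - 1) div ?d = p ^ a - 1"
  proof -
    obtain e where e: "order F - 1 = (p ^ a - 1) * e" using power_dvd(1)[OF a] by blast
    then have "?d = e" using power_dvd(2)[OF a] by simp
    moreover have "e \<noteq> 0" using e order_pos by (cases e) auto
    ultimately show "?d dvd order F - 1" "?d \<noteq> 0" "(order F - 1) div ?d = p ^ a - 1"
      using e by simp_all
  qed
  have "{x \<in> carrier F. x [^] (p ^ a - 1) = \<one>} = generate (mult_of F) {\<omega> [^] ?d}"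
    using subgroup_mult_of_eq_roots[OF fin generate_primitive_pow(1)[OF fin \<omega> d(1,2)]]
      generate_primitive_pow(2)[OF fin \<omega> d(1,2)] d(3) by simp
  then have "card {x \<in> carrier F. x [^] (p ^ a - 1) = \<one>} = p ^ a - 1"
    using generate_primitive_pow(2)[OF fin \<omega> d(1,2)] d(3) by simp
  moreover have "\<zero> \<notin> {x \<in> carrier F. x [^] (p ^ a - 1) = \<one>}"
    using power_dvd(2)[OF a] by (simp add: nat_pow_zero)
  ultimately have "card ?K = Suc (p ^ a - 1)" using fin unfolding K_eq by simp
  then show "card ?K = p ^ a" by (metis pa)
  obtain c where c: "p ^ a - 1 = n * c" using n by blast
  have "x [^] (p ^ a - 1) = \<one>" if "x \<in> S" for x
  proof -
    have "x \<in> carrier F" "x [^] n = \<one>" using that S_eq by auto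
    then show ?thesis unfolding c by (simp add: nat_pow_pow[symmetric])
  qed
  then have "S \<subseteq> ?K" unfolding K_eq using S_carrier by auto
  moreover have "subgroup ?K (add_monoid F)" using K by (intro subring.axioms(1) subfieldE(1))
  ultimately show "W \<subseteq> ?K" unfolding W_def by (rule add.generate_subgroup_incl)
qed

text \<open>An admissible a < r confines W to a subfield of order p ^ a < q. Conversely |W| = p ^ c,
  and c < r would make c admissible.\<close>

lemma W_eq_carrier_iff:
  "W = carrier F \<longleftrightarrow>
    (\<forall>a. 1 \<le> a \<and> a < r \<and> a dvd r \<longrightarrow> \<not> ((order F - 1) div (p ^ a - 1)) dvd k)"
proof
  assume W: "W = carrier F"
  show "\<forall>a. 1 \<le> a \<and> a < r \<and> a dvd r \<longrightarrow> \<not> ((order F - 1) div (p ^ a - 1)) dvd k"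
  proof (intro allI impI notI)
    fix a assume a: "1 \<le> a \<and> a < r \<and> a dvd r" and dvd: "(order F - 1) div (p ^ a - 1) dvd k"
    then obtain K where K: "subfield K F" "card K = p ^ a" "W \<subseteq> K"
      using dvd_k_iff subfield_of_divisor by blast
    have "K = carrier F" using K W subfieldE(3) by blast
    then have "p ^ a = p ^ r" using K order_F by (simp add: order_def)
    then show False using a prime_gt_1_nat[OF p] by simp
  qed
next
  assume no: "\<forall>a. 1 \<le> a \<and> a < r \<and> a dvd r \<longrightarrow> \<not> ((order F - 1) div (p ^ a - 1)) dvd k"
  obtain c where c: "1 \<le> c" "c dvd r" "card W = p ^ c" "n dvd p ^ c - 1" by (rule obtain_card_W)
  have "\<not> c < r" using no c dvd_k_iff by blast
  then have "c = r" using c(2) r by (auto dest: dvd_imp_le)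
  then have "card W = card (carrier F)" using c(3) order_F by (simp add: order_def)
  then show "W = carrier F" using W_carrier fin by (intro card_subset_eq)
qed

section \<open>Components as translates of \<open>W\<close>\<close>

lemma components_eq:
  "components (cay_graph F S) = (\<lambda>A. cay_graph F S \<restriction> A) ` (rcosets\<^bsub>add_monoid F\<^esub> W)"
  unfolding W_def using S_carrier S_uminus by (rule components_cay_graph)

lemma W_coset: "W \<in> rcosets\<^bsub>add_monoid F\<^esub> W"
  using add.coset_mult_one[of W] W_carrier by (auto simp: RCOSETS_def intro!: bexI[of _ \<zero>])

lemma translation_coset:
  assumes u: "u \<in> carrier F" and d: "d \<in> carrier F"
  shows "pre_digraph.digraph_isomorphism (cay_graph F S \<restriction> (W #>\<^bsub>add_monoid F\<^esub> u)) (translation d)"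
    and "app_iso (translation d) (cay_graph F S \<restriction> (W #>\<^bsub>add_monoid F\<^esub> u)) =
      cay_graph F S \<restriction> (W #>\<^bsub>add_monoid F\<^esub> (u \<oplus> d))"
proof -
  have A: "W #>\<^bsub>add_monoid F\<^esub> u \<subseteq> carrier F"
    using add.r_coset_subset_G[of W u] W_carrier u by simp
  have img: "(\<lambda>x. x \<oplus> d) ` (W #>\<^bsub>add_monoid F\<^esub> u) = W #>\<^bsub>add_monoid F\<^esub> (u \<oplus> d)"
  proof -
    have "(\<lambda>x. x \<oplus> d) ` A = A #>\<^bsub>add_monoid F\<^esub> d" for A by (auto simp: r_coset_def)
    then show ?thesis using add.coset_mult_assoc[of W u d] W_carrier u d by simp
  qed
  show "pre_digraph.digraph_isomorphism (cay_graph F S \<restriction> (W #>\<^bsub>add_monoid F\<^esub> u)) (translation d)"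
    using d A by (rule translation_cay_graph)
  show "app_iso (translation d) (cay_graph F S \<restriction> (W #>\<^bsub>add_monoid F\<^esub> u)) =
      cay_graph F S \<restriction> (W #>\<^bsub>add_monoid F\<^esub> (u \<oplus> d))"
    using translation_cay_graph(2)[OF d A] img by simp
qed

lemma components_iso:
  assumes "C \<in> components (cay_graph F S)" "D \<in> components (cay_graph F S)"
  shows "digraph_iso C D"
proof -
  obtain u v where u: "u \<in> carrier F" "C = cay_graph F S \<restriction> (W #>\<^bsub>add_monoid F\<^esub> u)"
    and v: "v \<in> carrier F" "D = cay_graph F S \<restriction> (W #>\<^bsub>add_monoid F\<^esub> v)"
    using assms by (auto simp: components_eq RCOSETS_def)
  have "u \<oplus> (v \<ominus> u) = v" using u v by (simp add: minus_eq a_comm[of v] r_neg2)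
  then show ?thesis
    unfolding digraph_iso_def
    using translation_coset[of u "v \<ominus> u"] u v by (metis minus_closed)
qed

lemma \<Gamma>0_coset: "W #>\<^bsub>add_monoid F\<^esub> \<zero> = W"
  using add.coset_mult_one[of W] W_carrier by simp

text \<open>Lagrange counts p ^ r / p ^ a cosets of W. An enumeration of them with representatives
  \<open>u i\<close> turns into the translations by \<open>u i\<close>.\<close>

lemma ex_component_identification:
  assumes card: "card W = p ^ a" and a: "a \<le> r"
  shows "\<exists>\<Phi>. component_identification (cay_graph F S) (cay_graph F S \<restriction> W) (p ^ (r - a)) \<Phi>"
proof -
  let ?RC = "rcosets\<^bsub>add_monoid F\<^esub> W"
  have "card ?RC * card W = order (add_monoid F)" by (rule add.lagrange[OF subgroup_W])
  then have "card ?RC * p ^ a = p ^ (r - a) * p ^ a"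
    using card order_F a by (simp add: order_def flip: power_add)
  then have "card ?RC = p ^ (r - a)" using prime_gt_0_nat[OF p] by simp
  moreover have "finite ?RC"
    using fin by (auto simp: RCOSETS_def)
  ultimately obtain e where e: "bij_betw e {1..p ^ (r - a)} ?RC"
    using ex_bij_betw_nat_finite_1 by metis
  have "\<exists>u. u \<in> carrier F \<and> e i = W #>\<^bsub>add_monoid F\<^esub> u" if "i \<in> {1..p ^ (r - a)}" for i
    using bij_betw_apply[OF e that] by (auto simp: RCOSETS_def)
  then obtain u where u: "u i \<in> carrier F" "e i = W #>\<^bsub>add_monoid F\<^esub> u i"
    if "i \<in> {1..p ^ (r - a)}" for i
    by metis
  have hom: "pre_digraph.digraph_isomorphism (cay_graph F S \<restriction> W) (translation (u i))"
    and app: "app_iso (translation (u i)) (cay_graph F S \<restriction> W) = cay_graph F S \<restriction> e i"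
    if "i \<in> {1..p ^ (r - a)}" for i
    using translation_coset[of \<zero> "u i", unfolded \<Gamma>0_coset] u[OF that] by simp_all
  have "inj_on (\<lambda>A. cay_graph F S \<restriction> A) ?RC"
    by (rule inj_onI) (metis induce_subgraph_verts)
  then have "bij_betw (\<lambda>A. cay_graph F S \<restriction> A) ?RC (components (cay_graph F S))"
    by (simp add: bij_betw_def components_eq)
  then have "bij_betw (\<lambda>i. cay_graph F S \<restriction> e i) {1..p ^ (r - a)} (components (cay_graph F S))"
    using bij_betw_trans[OF e] by (simp add: comp_def)
  then have "bij_betw (\<lambda>i. app_iso (translation (u i)) (cay_graph F S \<restriction> W)) {1..p ^ (r - a)}
      (components (cay_graph F S))"
    by (rule bij_betw_cong[THEN iffD1, rotated]) (erule app[symmetric])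
  then show ?thesis
    using hom unfolding component_identification_def
    by (intro exI[of _ "\<lambda>i. translation (u i)"]) blast
qed

lemma gpaley_W: "gpaley (F\<lparr>carrier := W\<rparr>) n = cay_graph F S \<restriction> W"
proof -
  interpret K: field "F\<lparr>carrier := W\<rparr>" using subfield_W by (rule subfield_iff(2))
  have "gpaley (F\<lparr>carrier := W\<rparr>) n = cay_graph (F\<lparr>carrier := W\<rparr>) S"
    using finite_subset[OF W_carrier fin] card_S
      subgroup_mult_of_subfield[OF subfield_W subgroup_S S_subset_W]
    by (intro K.gpaley_eq_cay_graph) auto
  then show ?thesis by (simp add: cay_graph_subfield[OF subfield_W])
qed

text \<open>From p ^ a - 1 = n c and q - 1 = n k the division defining k' is exact with k' = c.
  Hence (p ^ a - 1) / k' is again n = |S|, and the smaller Paley graph has the same connection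
  set.\<close>

lemma quotient_arith:
  assumes a: "1 \<le> a" "a dvd r" and n: "n dvd p ^ a - 1"
    and k': "k' = ((p ^ a - 1) * k) div (order F - 1)"
  shows "k' * (order F - 1) = (p ^ a - 1) * k" "1 \<le> k'" "k' dvd p ^ a - 1"
    and "(p ^ a - 1) div k' = n"
proof -
  obtain c where c: "p ^ a - 1 = n * c" using n by blast
  have "(p ^ a - 1) * k = c * (order F - 1)" by (simp only: c n_mult(1)[symmetric] ac_simps)
  then have k'c: "k' = c" using order_pos by (simp add: k')
  have "c > 0" using c power_dvd(2)[OF a] by (cases c) auto
  then show "k' * (order F - 1) = (p ^ a - 1) * k" "1 \<le> k'" "k' dvd p ^ a - 1"
    "(p ^ a - 1) div k' = n"
    using \<open>(p ^ a - 1) * k = c * (order F - 1)\<close> c k'c by simp_all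
qed

end


theorem theorem2p2:
  fixes F :: "'a ring" and \<omega> :: 'a and p R q k :: nat
    and S :: "'a set" and \<Gamma> :: "('a, 'a \<times> 'a) pre_digraph"
  assumes "Factorial_Ring.prime p" and "R \<ge> 1" and q_def: "q = p ^ R"
    and "field F" and "order F = q"
    and "k dvd q - 1" and "k \<ge> 2" and "even q \<or> even ((q - 1) div k)"
    and "\<omega> \<in> carrier (mult_of F)" and "generate (mult_of F) {\<omega>} = carrier (mult_of F)"
    and S_def: "S = generate (mult_of F) {\<omega> [^]\<^bsub>F\<^esub> k}"
    and \<Gamma>_def: "\<Gamma> = gpaley F ((q - 1) div k)"
  shows
    "graph \<Gamma> \<and> \<Gamma> = cay_graph F S \<and>
     \<comment> \<open>part (1)\<close>
     (Digraph_Component.connected \<Gamma> \<longleftrightarrow> primitive_scheme (cyc F \<omega> k)) \<and>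
     (Digraph_Component.connected \<Gamma> \<longleftrightarrow>
        acts_irreducibly F (generate (BijGroup (carrier F))
          {mult_map F \<omega> [^]\<^bsub>BijGroup (carrier F)\<^esub> k})) \<and>
     (Digraph_Component.connected \<Gamma> \<longleftrightarrow>
        (\<forall>a. 1 \<le> a \<and> a < R \<and> a dvd R \<longrightarrow> \<not> ((q - 1) div (p ^ a - 1)) dvd k)) \<and>
     \<comment> \<open>part (2)\<close>
     (\<forall>a k'. 1 \<le> a \<and> a < R \<and> a dvd R \<and> ((q - 1) div (p ^ a - 1)) dvd k \<and>
        k' = ((p ^ a - 1) * k) div (q - 1) \<longrightarrow>
        \<not> Digraph_Component.connected \<Gamma> \<and>
        (\<forall>C \<in> components \<Gamma>. \<forall>D \<in> components \<Gamma>. digraph_iso C D) \<and>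
        k' * (q - 1) = (p ^ a - 1) * k \<and> k' \<ge> 1 \<and> k' dvd p ^ a - 1 \<and>
        (\<exists>\<Gamma>0 K. \<Gamma>0 \<in> components \<Gamma> \<and> \<zero>\<^bsub>F\<^esub> \<in> verts \<Gamma>0 \<and>
           subfield K F \<and> card K = p ^ a \<and> K \<subset> carrier F \<and>
           S \<subseteq> verts \<Gamma>0 \<and> verts \<Gamma>0 \<subseteq> K \<and>
           \<comment> \<open>the remaining claims need \<open>a\<close> to be the least admissible divisor; they fail for larger ones\<close>
           ((\<forall>a'. 1 \<le> a' \<and> a' < R \<and> a' dvd R \<and> ((q - 1) div (p ^ a' - 1)) dvd k \<longrightarrow> a \<le> a') \<longrightarrow>
              verts \<Gamma>0 = K \<and>
              digraph_iso \<Gamma>0 (gpaley (F\<lparr>carrier := K\<rparr>) ((p ^ a - 1) div k')) \<and>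
              (\<exists>\<Phi>. component_identification \<Gamma> \<Gamma>0 (p ^ (R - a)) \<Phi>) \<and>
              (\<forall>\<Phi>. component_identification \<Gamma> \<Gamma>0 (p ^ (R - a)) \<Phi> \<longrightarrow>
                 wreath_action \<Gamma> \<Gamma>0 (p ^ (R - a)) \<Phi>
                   \<in> iso (wreath_sym (aut_group \<Gamma>0) (p ^ (R - a))) (aut_group \<Gamma>)))))"
proof -
  interpret G: gpaley_setting F \<omega> p R k
    using assms by (simp add: gpaley_setting_def gpaley_setting_axioms_def)
  have S: "S = G.S" by (simp add: S_def G.S_def)
  have q: "q = order F" using assms by simp
  have \<Gamma>: "\<Gamma> = cay_graph F G.S" using G.gpaley_eq by (simp add: \<Gamma>_def G.n_def q)
  note admissible = G.W_eq_carrier_iff[folded q]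
  have part2:
    "\<not> Digraph_Component.connected \<Gamma> \<and>
        (\<forall>C \<in> components \<Gamma>. \<forall>D \<in> components \<Gamma>. digraph_iso C D) \<and>
        k' * (q - 1) = (p ^ a - 1) * k \<and> k' \<ge> 1 \<and> k' dvd p ^ a - 1 \<and>
        (\<exists>\<Gamma>0 K. \<Gamma>0 \<in> components \<Gamma> \<and> \<zero>\<^bsub>F\<^esub> \<in> verts \<Gamma>0 \<and>
           subfield K F \<and> card K = p ^ a \<and> K \<subset> carrier F \<and>
           S \<subseteq> verts \<Gamma>0 \<and> verts \<Gamma>0 \<subseteq> K \<and>
           ((\<forall>a'. 1 \<le> a' \<and> a' < R \<and> a' dvd R \<and> ((q - 1) div (p ^ a' - 1)) dvd k \<longrightarrow> a \<le> a') \<longrightarrow>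
              verts \<Gamma>0 = K \<and>
              digraph_iso \<Gamma>0 (gpaley (F\<lparr>carrier := K\<rparr>) ((p ^ a - 1) div k')) \<and>
              (\<exists>\<Phi>. component_identification \<Gamma> \<Gamma>0 (p ^ (R - a)) \<Phi>) \<and>
              (\<forall>\<Phi>. component_identification \<Gamma> \<Gamma>0 (p ^ (R - a)) \<Phi> \<longrightarrow>
                 wreath_action \<Gamma> \<Gamma>0 (p ^ (R - a)) \<Phi>
                   \<in> iso (wreath_sym (aut_group \<Gamma>0) (p ^ (R - a))) (aut_group \<Gamma>))))"
    if ak: "1 \<le> a \<and> a < R \<and> a dvd R \<and> ((q - 1) div (p ^ a - 1)) dvd k \<and>
      k' = ((p ^ a - 1) * k) div (q - 1)" for a k'
  proof -
    have a: "1 \<le> a" "a dvd R" and n: "G.n dvd p ^ a - 1"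
      using ak G.dvd_k_iff[of a] by (auto simp: q)
    have W: "G.W \<noteq> carrier F" using ak admissible by blast
    obtain K where K: "subfield K F" "card K = p ^ a" "G.W \<subseteq> K"
      using G.subfield_of_divisor[OF a n] by blast
    have Kc: "K \<subseteq> carrier F" using K(1) by (rule subfieldE)
    have finK: "finite K" using Kc G.fin by (rule finite_subset)
    have "card K \<noteq> card (carrier F)"
      using K(2) G.order_F ak prime_gt_1_nat[OF G.p] by (simp add: order_def)
    then have Kproper: "K \<subset> carrier F" using Kc by blast
    let ?\<Gamma>0 = "\<Gamma> \<restriction> G.W"
    have comp: "?\<Gamma>0 \<in> components \<Gamma>" using G.W_coset by (simp add: \<Gamma> G.components_eq)
    have arith: "k' * (q - 1) = (p ^ a - 1) * k" "1 \<le> k'" "k' dvd p ^ a - 1"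
      "(p ^ a - 1) div k' = G.n"
      using G.quotient_arith[OF a n, of k'] ak by (auto simp: q)
    \<comment> \<open>The exponent c of |W| is either admissible, so a \<le> c by minimality, or
      equal to R. Hence |K| \<le> |W|, while W lies in K.\<close>
    have minimal: "G.W = K"
      if least: "\<forall>a'. 1 \<le> a' \<and> a' < R \<and> a' dvd R \<and> ((q - 1) div (p ^ a' - 1)) dvd k \<longrightarrow> a \<le> a'"
    proof -
      obtain c where c: "1 \<le> c" "c dvd R" "card G.W = p ^ c" "G.n dvd p ^ c - 1"
        by (rule G.obtain_card_W)
      have "a \<le> c"
      proof (cases "c < R")
        case True
        then show ?thesis using least c G.dvd_k_iff[OF c(1,2)] q by blast
      qed (use ak in auto)
      then have "card K \<le> card G.W"
        using K(2) c(3) prime_gt_0_nat[OF G.p] by (simp add: power_increasing)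
      then show ?thesis using finK K(3) by (intro card_seteq)
    qed
    have \<Gamma>0_verts: "verts ?\<Gamma>0 = G.W" by simp
    \<comment> \<open>After rewriting, both graphs are literally the same component;
      \<open>components_iso\<close> with C = D supplies reflexivity.\<close>
    have iso: "digraph_iso ?\<Gamma>0 (gpaley (F\<lparr>carrier := G.W\<rparr>) ((p ^ a - 1) div k'))"
      using G.components_iso comp unfolding arith(4) G.gpaley_W \<Gamma> by blast
    have ex: "\<exists>\<Phi>. component_identification \<Gamma> ?\<Gamma>0 (p ^ (R - a)) \<Phi>" if "G.W = K"
      using G.ex_component_identification[of a] K(2) ak that by (simp add: \<Gamma>)
    have wreath: "wreath_action \<Gamma> ?\<Gamma>0 b \<Phi> \<in> iso (wreath_sym (aut_group ?\<Gamma>0) b) (aut_group \<Gamma>)"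
      if "component_identification \<Gamma> ?\<Gamma>0 b \<Phi>" for b \<Phi>
      using G.graph_\<Gamma> G.fin comp that unfolding \<Gamma>
      by (intro sym_digraph.wreath_action_iso G.sym_digraph_cay_graph G.S_uminus) auto
    have zero: "\<zero>\<^bsub>F\<^esub> \<in> G.W" using subringE(2)[OF subfieldE(1)[OF G.subfield_W]] .
    have "?\<Gamma>0 \<in> components \<Gamma> \<and> \<zero>\<^bsub>F\<^esub> \<in> verts ?\<Gamma>0 \<and>
           subfield K F \<and> card K = p ^ a \<and> K \<subset> carrier F \<and>
           S \<subseteq> verts ?\<Gamma>0 \<and> verts ?\<Gamma>0 \<subseteq> K \<and>
           ((\<forall>a'. 1 \<le> a' \<and> a' < R \<and> a' dvd R \<and> ((q - 1) div (p ^ a' - 1)) dvd k \<longrightarrow> a \<le> a') \<longrightarrow>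
              verts ?\<Gamma>0 = K \<and>
              digraph_iso ?\<Gamma>0 (gpaley (F\<lparr>carrier := K\<rparr>) ((p ^ a - 1) div k')) \<and>
              (\<exists>\<Phi>. component_identification \<Gamma> ?\<Gamma>0 (p ^ (R - a)) \<Phi>) \<and>
              (\<forall>\<Phi>. component_identification \<Gamma> ?\<Gamma>0 (p ^ (R - a)) \<Phi> \<longrightarrow>
                 wreath_action \<Gamma> ?\<Gamma>0 (p ^ (R - a)) \<Phi>
                   \<in> iso (wreath_sym (aut_group ?\<Gamma>0) (p ^ (R - a))) (aut_group \<Gamma>)))"
      unfolding \<Gamma>0_verts S
    proof (intro conjI impI allI comp zero K Kproper G.S_subset_W)
      assume least: "\<forall>a'. 1 \<le> a' \<and> a' < R \<and> a' dvd R \<and> ((q - 1) div (p ^ a' - 1)) dvd k \<longrightarrow> a \<le> a'"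
      have WK: "G.W = K" using least by (rule minimal)
      then show "G.W = K" .
      show "digraph_iso ?\<Gamma>0 (gpaley (F\<lparr>carrier := K\<rparr>) ((p ^ a - 1) div k'))"
        using iso WK by simp
      show "\<exists>\<Phi>. component_identification \<Gamma> ?\<Gamma>0 (p ^ (R - a)) \<Phi>" using WK by (rule ex)
    qed (rule wreath)
    moreover have "\<not> Digraph_Component.connected \<Gamma>" using W G.connected_iff by (simp add: \<Gamma>)
    moreover have "\<forall>C \<in> components \<Gamma>. \<forall>D \<in> components \<Gamma>. digraph_iso C D"
      using G.components_iso by (simp add: \<Gamma>)
    ultimately show ?thesis using arith(1-3) by blast
  qed
  show ?thesis
  proof (intro conjI)
    show "graph \<Gamma>" using G.graph_\<Gamma> by (simp add: \<Gamma>)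
    show "\<Gamma> = cay_graph F S" by (simp add: \<Gamma> S)
    show "Digraph_Component.connected \<Gamma> \<longleftrightarrow> primitive_scheme (cyc F \<omega> k)"
      using G.connected_iff G.primitive_iff by (simp add: \<Gamma>)
    show "Digraph_Component.connected \<Gamma> \<longleftrightarrow>
        acts_irreducibly F (generate (BijGroup (carrier F))
          {mult_map F \<omega> [^]\<^bsub>BijGroup (carrier F)\<^esub> k})"
      using G.connected_iff G.irreducible_iff by (simp add: \<Gamma>)
    show "Digraph_Component.connected \<Gamma> \<longleftrightarrow>
        (\<forall>a. 1 \<le> a \<and> a < R \<and> a dvd R \<longrightarrow> \<not> ((q - 1) div (p ^ a - 1)) dvd k)"
      using G.connected_iff admissible by (simp add: \<Gamma>)
  qed (intro allI impI, rule part2)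
qed

end
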